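(* For every $k\in\mathbb{N}$ and all positive integers $\ell_1,\ldots,\ell_k$, there exists $n_0$ such that if $\sigma$ is the layered permutation with layers of sizes $(n,1,\ell_1,\dots,\ell_k)$ where $n\ge n_0$, then every $\sigma$-optimal layered permuton has infinitely many layers.
   Context: A layered permutation $\sigma$ of order $m$ with layers of sizes $(a_1,\ldots,a_r)$: $[m]$ is partitioned into consecutive intervals $I_1,\ldots,I_r$ (in order) with $|I_j|=a_j$, $\sigma$ decreasing on each $I_j$, and $\sigma(x)<\sigma(x')$ for $x\in I_j,x'\in I_{j'}$, $j<j'$. A permuton is a Borel probability measure $\Pi$ on $[0,1]^2$ with uniform marginals; a $\Pi$-random permutation of order $m$ is obtained by sampling $m$ independent points from $\Pi$, ordering them by $x$-coordinate and taking the relative order of their $y$-coordinates; $d(\sigma,\Pi)$ is the probability that a $\Pi$-random permutation of order $|\sigma|$ is $\sigma$. $\Pi$ is $\sigma$-optimal if $d(\sigma,\Pi)$ equals the packing density of $\sigma$, i.e. $\lim_{n\to\infty}\max\{d(\sigma,\pi):|\pi|=n\}$ where $d(\sigma,\pi)$ is the probability that $|\sigma|$ random distinct positions of the permutation $\pi$ induce $\sigma$ (equivalently, $d(\sigma,\Pi)$ is maximum over all permutons). A permuton $\Pi$ is layered if there is a collection $\mathcal{J}$ of internally disjoint closed subintervals of $[0,1]$ (possibly of length zero) such that the support of $\Pi$ consists exactly of the points $(x,y)$ with $x\in[a,b]\in\mathcal{J}$ and $y=b-(x-a)$; the elements of $\mathcal{J}$ are its layers and the number of layers is $|\mathcal{J}|$.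 *)

theory Defs
  imports "HOL-Probability.Probability" "HOL-Combinatorics.Permutations"
begin

text \<open>A permutation of order \<open>m\<close> is a function \<open>\<sigma>\<close> with \<open>\<sigma> permutes {1..m}\<close>; since \<open>m\<close> cannot be
  recovered from \<open>\<sigma>\<close>, the order is passed as a separate argument.\<close>

definition layer_interval :: "nat list \<Rightarrow> nat \<Rightarrow> nat set" where
  "layer_interval as j = {sum_list (take j as)<..sum_list (take (Suc j) as)}"

definition layered_perm :: "nat list \<Rightarrow> (nat \<Rightarrow> nat) \<Rightarrow> bool" where
  "layered_perm as \<sigma> \<longleftrightarrow>
     \<sigma> permutes {1..sum_list as} \<and>
     (\<forall>j<length as. \<forall>x\<in>layer_interval as j. \<forall>x'\<in>layer_interval as j. x < x' \<longrightarrow> \<sigma> x' < \<sigma> x) \<and>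
     (\<forall>j'<length as. \<forall>j<j'. \<forall>x\<in>layer_interval as j. \<forall>x'\<in>layer_interval as j'. \<sigma> x < \<sigma> x')"

text \<open>The witness \<open>e\<close> is the increasing enumeration of the set \<open>S\<close> of positions.\<close>

definition induces :: "nat \<Rightarrow> (nat \<Rightarrow> nat) \<Rightarrow> (nat \<Rightarrow> nat) \<Rightarrow> nat set \<Rightarrow> bool" where
  "induces m \<sigma> \<pi> S \<longleftrightarrow>
     (\<exists>e. strict_mono_on {1..m} e \<and> e ` {1..m} = S \<and>
       (\<forall>i\<in>{1..m}. \<forall>j\<in>{1..m}. \<sigma> i < \<sigma> j \<longleftrightarrow> \<pi> (e i) < \<pi> (e j)))"

definition perm_density :: "nat \<Rightarrow> (nat \<Rightarrow> nat) \<Rightarrow> nat \<Rightarrow> (nat \<Rightarrow> nat) \<Rightarrow> real" where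
  "perm_density m \<sigma> n \<pi> =
     real (card {S. S \<subseteq> {1..n} \<and> card S = m \<and> induces m \<sigma> \<pi> S}) / real (n choose m)"

definition packing_density :: "nat \<Rightarrow> (nat \<Rightarrow> nat) \<Rightarrow> real" where
  "packing_density m \<sigma> = lim (\<lambda>n. Max {perm_density m \<sigma> n \<pi> | \<pi>. \<pi> permutes {1..n}})"

text \<open>Permutons are Borel measures on the whole plane; the uniform marginals force them to be
  concentrated on the unit square.\<close>

definition permuton :: "(real \<times> real) measure \<Rightarrow> bool" where
  "permuton P \<longleftrightarrow>
     prob_space P \<and> sets P = sets borel \<and>
     distr P borel fst = uniform_measure lborel {0..1} \<and>
     distr P borel snd = uniform_measure lborel {0..1}"

text \<open>The permutation \<open>\<tau>\<close> sorts the sampled points by \<open>x\<close>-coordinate. Samples with two equal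
  coordinates induce no permutation; for a permuton they form a null set.\<close>

definition permuton_density :: "nat \<Rightarrow> (nat \<Rightarrow> nat) \<Rightarrow> (real \<times> real) measure \<Rightarrow> real" where
  "permuton_density m \<sigma> P =
     measure (Pi\<^sub>M {1..m} (\<lambda>_. P))
       {p \<in> space (Pi\<^sub>M {1..m} (\<lambda>_. P)).
          \<exists>\<tau>. \<tau> permutes {1..m} \<and>
            (\<forall>i\<in>{1..m}. \<forall>j\<in>{1..m}. i < j \<longrightarrow> fst (p (\<tau> i)) < fst (p (\<tau> j))) \<and>
            (\<forall>i\<in>{1..m}. \<forall>j\<in>{1..m}. \<sigma> i < \<sigma> j \<longleftrightarrow> snd (p (\<tau> i)) < snd (p (\<tau> j)))}"

definition optimal_permuton :: "nat \<Rightarrow> (nat \<Rightarrow> nat) \<Rightarrow> (real \<times> real) measure \<Rightarrow> bool" where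
  "optimal_permuton m \<sigma> P \<longleftrightarrow> permuton P \<and> permuton_density m \<sigma> P = packing_density m \<sigma>"

definition measure_support :: "'a::topological_space measure \<Rightarrow> 'a set" where
  "measure_support M = {z. \<forall>U. open U \<and> z \<in> U \<longrightarrow> emeasure M U > 0}"

text \<open>\<open>layering P J\<close>: the permuton \<open>P\<close> is layered with collection of layers \<open>J\<close>. The collection is
  determined by \<open>P\<close> except that the midpoint of a nondegenerate layer may or may not also be listed
  as a layer of length zero; this does not affect whether \<open>J\<close> is finite.\<close>

definition layering :: "(real \<times> real) measure \<Rightarrow> real set set \<Rightarrow> bool" where
  "layering P J \<longleftrightarrow>
     permuton P \<and>
     (\<forall>I\<in>J. \<exists>a b. 0 \<le> a \<and> a \<le> b \<and> b \<le> 1 \<and> I = {a..b}) \<and>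
     disjoint_family_on interior J \<and>
     measure_support P = {(x, y). \<exists>a b. {a..b} \<in> J \<and> x \<in> {a..b} \<and> y = b - (x - a)}"

end

theory Submission
  imports Defs
begin

text \<open>
  The density of a pattern with layer sizes \<open>a\<^sub>1, \<dots>, a\<^sub>r\<close> in a permuton with finitely many layers of
  lengths \<open>p\<^sub>1, \<dots>, p\<^sub>N\<close> is a multinomial coefficient times
  \<open>\<Sum>i\<^sub>1 < \<dots> < i\<^sub>r. p\<^bsub>i\<^sub>1\<^esub>\<^bsup>a\<^sub>1\<^esup> \<cdots> p\<^bsub>i\<^sub>r\<^esub>\<^bsup>a\<^sub>r\<^esup>\<close>, and discretizing any such \<open>p\<close> shows that the
  packing density is at least this large. So it suffices that, for the layer sizes
  \<open>(n, 1, l\<^sub>1, \<dots>, l\<^sub>k)\<close> with \<open>n\<close> large, no finite \<open>p\<close> maximizes the polynomial. If \<open>p\<close> were a maximizer,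
  comparison with a fixed \<open>p\<close> having first layer \<open>9/10\<close> forces a layer of length \<open>a \<ge> 8/10\<close>, and all
  contributions in which another layer plays the role of \<open>n\<close> are at most of order \<open>(2/10)\<^sup>n\<close>. Hence
  merging everything in front of the large layer into it is a strict gain unless the large layer
  is the first one. The second layer, of length \<open>b\<close>, then only plays the role of \<open>1\<close>, up to
  contributions of order \<open>b\<^sup>n\<close>; splitting it into halves costs nothing in that role and creates new
  copies in which the halves play the roles of \<open>1\<close> and \<open>l\<^sub>1\<close>, a gain of order \<open>a\<^sup>n b\<^bsup>l\<^sub>1 + 1\<^esup>\<close>. For \<open>k = 0\<close>
  splitting the last layer is a strict gain.
\<close>

subsection \<open>Packing polynomials of layered patterns\<close>

text \<open>The sum over index choices i_1 < ... < i_r of the products of \<open>f x a\<close> at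
  the chosen entries. It is generic in \<open>f\<close> and in the semiring because it serves both
  for powers (densities) and for binomial coefficients (counts of copies).\<close>

fun pattern_sum :: "('b \<Rightarrow> nat \<Rightarrow> 'c::comm_semiring_1) \<Rightarrow> nat list \<Rightarrow> 'b list \<Rightarrow> 'c" where
  "pattern_sum f [] xs = 1"
| "pattern_sum f (a # as) [] = 0"
| "pattern_sum f (a # as) (x # xs) = f x a * pattern_sum f as xs + pattern_sum f (a # as) xs"

abbreviation layer_poly :: "nat list \<Rightarrow> real list \<Rightarrow> real" where
  "layer_poly \<equiv> pattern_sum (\<lambda>x a. x ^ a)"

lemma pattern_sum_nonneg:
  fixes f :: "'b \<Rightarrow> nat \<Rightarrow> real"
  assumes "\<And>x a. x \<in> set xs \<Longrightarrow> 0 \<le> f x a"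
  shows "0 \<le> pattern_sum f as xs"
  using assms by (induction f as xs rule: pattern_sum.induct) auto

lemma layer_poly_nonneg: "\<forall>x\<in>set p. 0 \<le> x \<Longrightarrow> 0 \<le> layer_poly as p"
  by (rule pattern_sum_nonneg) auto

lemma layer_poly_pos:
  assumes "length as \<le> length p" "\<forall>x\<in>set p. 0 < x"
  shows "0 < layer_poly as p"
  using assms
proof (induction as arbitrary: p)
  case (Cons a as)
  then obtain x q where p: "p = x # q" by (cases p) auto
  have "0 < x ^ a * layer_poly as q" using Cons p by auto
  moreover have "0 \<le> layer_poly (a # as) q"
    using Cons.prems p by (intro layer_poly_nonneg) (auto simp: less_imp_le)
  ultimately show ?case using p by simp
qed simp

text \<open>Positive exponents make every term through a zero entry vanish. This turns the weights
  of a permuton, known only to be nonnegative, into the positive entries required by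
  \<open>prob_list\<close>.\<close>

lemma layer_poly_filter_pos:
  assumes "\<forall>a\<in>set as. 0 < a" "\<forall>x\<in>set p. 0 \<le> x"
  shows "layer_poly as (filter (\<lambda>x. 0 < x) p) = layer_poly as p"
  using assms
proof (induction "\<lambda>x a. x ^ a :: real" as p rule: pattern_sum.induct)
  case (3 a as x xs)
  then show ?case by (cases "x = 0") (auto simp: zero_power)
qed auto

lemma layer_poly_le_Cons:
  assumes "\<forall>x\<in>set (y # p). 0 \<le> x"
  shows "layer_poly as p \<le> layer_poly as (y # p)"
  using assms layer_poly_nonneg[of p] by (cases as) auto

text \<open>Dropping the requirement that the entry chosen for \<open>a\<close> come strictly before
  the others only adds nonnegative terms.\<close>

lemma layer_poly_Cons_le:
  assumes "\<forall>x\<in>set p. 0 \<le> x"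
  shows "layer_poly (a # as) p \<le> (\<Sum>x\<leftarrow>p. x ^ a) * layer_poly as p"
  using assms
proof (induction p)
  case (Cons y p)
  have "layer_poly (a # as) (y # p) \<le> y ^ a * layer_poly as p + (\<Sum>x\<leftarrow>p. x ^ a) * layer_poly as p"
    using Cons by simp
  also have "\<dots> = (\<Sum>x\<leftarrow>y # p. x ^ a) * layer_poly as p" by (simp add: algebra_simps)
  also have "\<dots> \<le> (\<Sum>x\<leftarrow>y # p. x ^ a) * layer_poly as (y # p)"
    using Cons.prems by (intro mult_left_mono layer_poly_le_Cons sum_list_nonneg) auto
  finally show ?case .
qed simp

lemma sum_list_power_le:
  fixes t :: real
  assumes "\<forall>x\<in>set p. 0 \<le> x \<and> x \<le> t"
  shows "(\<Sum>x\<leftarrow>p. x ^ Suc n) \<le> t ^ n * sum_list p"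
proof -
  have "(\<Sum>x\<leftarrow>p. x ^ Suc n) \<le> (\<Sum>x\<leftarrow>p. t ^ n * x)"
    using assms by (intro sum_list_mono) (auto intro!: mult_left_mono power_mono simp: mult.commute[of "t ^ n"])
  then show ?thesis by (simp add: sum_list_const_mult)
qed

lemma sum_list_member_le:
  fixes p :: "real list"
  shows "\<forall>x\<in>set p. 0 \<le> x \<Longrightarrow> x \<in> set p \<Longrightarrow> x \<le> sum_list p"
  by (rule member_le_sum_list) auto

text \<open>The exponents are peeled off by \<open>layer_poly_Cons_le\<close>, each at the cost of a
  power sum of at most \<open>sum_list p\<close>.\<close>

lemma layer_poly_le_1:
  assumes "\<forall>a\<in>set as. 0 < a" "\<forall>x\<in>set p. 0 \<le> x" "sum_list p \<le> 1"
  shows "layer_poly as p \<le> 1"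
  using assms(1)
proof (induction as)
  case (Cons a as)
  then obtain n where a: "a = Suc n" by (cases a) auto
  have le1: "x \<le> 1" if "x \<in> set p" for x
    using sum_list_member_le[OF assms(2) that] assms(3) by simp
  have "layer_poly (a # as) p \<le> (\<Sum>x\<leftarrow>p. x ^ a) * layer_poly as p"
    by (rule layer_poly_Cons_le[OF assms(2)])
  also have "\<dots> \<le> 1 * 1"
  proof (rule mult_mono)
    show "(\<Sum>x\<leftarrow>p. x ^ a) \<le> 1"
      using sum_list_power_le[of p 1 n] le1 assms a by auto
  qed (use Cons layer_poly_nonneg[OF assms(2)] in auto)
  finally show ?case by simp
qed simp

text \<open>When an entry y of \<open>u\<close> takes the exponent \<open>n\<close>, the other
  factors sum to at most 1 by \<open>layer_poly_le_1\<close>, so these terms amount to at most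
  y^n.\<close>

lemma layer_poly_append_le:
  assumes "\<forall>a\<in>set as. 0 < a" "\<forall>x\<in>set (u @ r). 0 \<le> x" "sum_list (u @ r) \<le> 1"
  shows "layer_poly (n # as) (u @ r) \<le> (\<Sum>x\<leftarrow>u. x ^ n) + layer_poly (n # as) r"
  using assms
proof (induction u)
  case (Cons y u)
  have "layer_poly as (u @ r) \<le> 1" using Cons.prems by (intro layer_poly_le_1) auto
  then have "y ^ n * layer_poly as (u @ r) \<le> y ^ n"
    using Cons.prems by (intro mult_left_le) auto
  then show ?case using Cons by simp
qed simp

section \<open>Exponential comparisons and the effect of merging or splitting layers\<close>

lemma eventually_power_less:
  fixes x y K c :: real
  assumes "0 \<le> x" "x < y" "0 < c"
  shows "eventually (\<lambda>n. K * x ^ n < c * y ^ n) sequentially"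
proof -
  have "(\<lambda>n. K * (x / y) ^ n) \<longlonglongrightarrow> K * 0"
    using assms by (intro tendsto_mult tendsto_const LIMSEQ_power_zero) auto
  then have "eventually (\<lambda>n. K * (x / y) ^ n < c) sequentially"
    using assms by (intro order_tendstoD(2)[where y = "K * 0"]) auto
  then show ?thesis
    by eventually_elim (use assms in \<open>auto simp: power_divide field_simps\<close>)
qed

text \<open>Let s be the total of \<open>u\<close> and W the polynomial of \<open>as\<close> on
  \<open>v\<close>. Terms with the large exponent on \<open>u\<close> are at most t^n s in all,
  while moving the mass s into \<open>a\<close> gains at least s a^n W, as (s + a)^(n+1) >= (s + a)
  a^n. The exponent is \<open>Suc n\<close> so that loss and gain both carry the factor s.\<close>

lemma layer_poly_merge_less:
  fixes a D :: real
  assumes as: "\<forall>b\<in>set as. 0 < b" and nonneg: "\<forall>x\<in>set (u @ a # v). 0 \<le> x" and sum: "sum_list (u @ a # v) = 1"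
    and u: "\<forall>x\<in>set u. x \<le> t" and pos: "0 < sum_list u"
    and gain: "t ^ n < a ^ n * layer_poly as v"
  shows "layer_poly (Suc n # as) (u @ a # v) < layer_poly (Suc n # as) ((sum_list u + a) # v)"
proof -
  let ?s = "sum_list u" and ?W = "layer_poly as v"
  have W: "0 \<le> ?W" using nonneg by (intro layer_poly_nonneg) auto
  have "layer_poly (Suc n # as) (u @ a # v) \<le> (\<Sum>x\<leftarrow>u. x ^ Suc n) + layer_poly (Suc n # as) (a # v)"
    using as nonneg sum by (intro layer_poly_append_le) auto
  also have "\<dots> \<le> t ^ n * ?s + layer_poly (Suc n # as) (a # v)"
    using u nonneg by (intro add_right_mono sum_list_power_le) auto
  also have "\<dots> < (a ^ n * ?W) * ?s + layer_poly (Suc n # as) (a # v)"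
    using gain pos by simp
  also have "\<dots> = (?s + a) * a ^ n * ?W + layer_poly (Suc n # as) v"
    by (simp add: algebra_simps)
  also have "\<dots> \<le> (?s + a) * (?s + a) ^ n * ?W + layer_poly (Suc n # as) v"
    using nonneg pos W by (intro add_right_mono mult_right_mono mult_left_mono power_mono) auto
  finally show ?thesis by simp
qed

text \<open>Expand by the roles of the first two entries and put h = b/2. With \<open>a\<close> in
  the role of \<open>n\<close>, halving \<open>b\<close> preserves the terms with \<open>b\<close>
  in the role of 1 and adds a^n h^(l+1) times the polynomial of \<open>ls\<close> on
  \<open>w\<close>. The only terms at risk have \<open>b\<close> in the role of \<open>n\<close>;
  they total b^n times the polynomial of \<open>1 # l # ls\<close> on \<open>w\<close>.\<close>

lemma layer_poly_split_less:
  assumes nonneg: "\<forall>x\<in>set w. 0 \<le> x" "sum_list w \<le> 1" and ls: "\<forall>i\<in>set (l # ls). 0 < i"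
    and ab: "0 \<le> a" "0 < b" and gain: "b ^ n < a ^ n * (b / 2) ^ Suc l"
    and pos: "0 < layer_poly (n # 1 # l # ls) (a # b # w)"
  shows "layer_poly (n # 1 # l # ls) (a # b # w) < layer_poly (n # 1 # l # ls) (a # b / 2 # b / 2 # w)"
proof -
  let ?h = "b / 2" and ?R = "l # ls"
  \<comment> \<open>The entries sum to at most 1, hence so do their powers, and removing a leading
    exponent cannot decrease the polynomial.\<close>
  have le: "layer_poly (i # as) w \<le> layer_poly as w" if i0: "0 < i" for i as
  proof -
    obtain j where i: "i = Suc j" using i0 by (cases i) auto
    have "\<forall>x\<in>set w. 0 \<le> x \<and> x \<le> 1"
      using nonneg sum_list_member_le[OF nonneg(1)] by (meson order_trans)
    from sum_list_power_le[OF this, of j] have "(\<Sum>x\<leftarrow>w. x ^ i) \<le> 1"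
      unfolding i using nonneg(2) by (simp only: power_one mult_1 order_trans)
    then have "(\<Sum>x\<leftarrow>w. x ^ i) * layer_poly as w \<le> 1 * layer_poly as w"
      using nonneg(1) by (intro mult_right_mono layer_poly_nonneg)
    then show ?thesis
      using layer_poly_Cons_le[OF nonneg(1), of i as] by simp
  qed
  have W0: "0 \<le> layer_poly as w" for as using nonneg layer_poly_nonneg by auto
  have le': "layer_poly (1 # ?R) w \<le> layer_poly ls w"
    using le[of 1 ?R] le[of l ls] ls by simp
  \<comment> \<open>Otherwise every polynomial on \<open>w\<close> in the expansion vanishes, and
    with them the value assumed positive in \<open>pos\<close>.\<close>
  have "0 < layer_poly ls w"
  proof (rule ccontr)
    assume "\<not> 0 < layer_poly ls w"
    then have 0: "layer_poly ls w = 0" using W0[of ls] by simp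
    then have "layer_poly ?R w = 0" using W0[of ?R] le[of l ls] ls by simp
    moreover have "layer_poly (1 # ?R) w = 0" using W0[of "1 # ?R"] le' 0 by simp
    moreover have "layer_poly (n # 1 # ?R) w = 0"
      using W0[of "n # 1 # ?R"] layer_poly_Cons_le[OF nonneg(1), of n "1 # ?R"] calculation by simp
    ultimately show False using pos by simp
  qed
  then have "b ^ n * layer_poly (1 # ?R) w < a ^ n * ?h ^ Suc l * layer_poly ls w"
    using gain le' ab by (intro le_less_trans[OF mult_left_mono[OF le']] mult_strict_right_mono) auto
  moreover have "0 \<le> ?h ^ n * layer_poly (1 # ?R) (?h # w)" "0 \<le> ?h ^ n * layer_poly (1 # ?R) w"
    using ab nonneg by (auto intro!: mult_nonneg_nonneg layer_poly_nonneg simp del: pattern_sum.simps)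
  ultimately show ?thesis by (simp add: algebra_simps)
qed

text \<open>For b = x + y the second value exceeds the first by \<open>x ^ n * y\<close>, which is
  what splitting the last entry creates.\<close>

lemma layer_poly_snoc_pair:
  "layer_poly [n, 1] (p @ [b]) = layer_poly [n, 1] p + (\<Sum>x\<leftarrow>p. x ^ n) * b"
  "layer_poly [n, 1] (p @ [x, y]) = layer_poly [n, 1] p + (\<Sum>x\<leftarrow>p. x ^ n) * (x + y) + x ^ n * y"
proof -
  have 1: "layer_poly [1] (p @ q) = layer_poly [1] p + sum_list q" for p q :: "real list"
  proof (induction p)
    case Nil show ?case by (induction q) auto
  qed auto
  show "layer_poly [n, 1] (p @ [b]) = layer_poly [n, 1] p + (\<Sum>x\<leftarrow>p. x ^ n) * b"
    using 1[of _ "[b]"] by (induction p) (auto simp: algebra_simps)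
  show "layer_poly [n, 1] (p @ [x, y]) = layer_poly [n, 1] p + (\<Sum>x\<leftarrow>p. x ^ n) * (x + y) + x ^ n * y"
    using 1[of _ "[x, y]"] by (induction p) (auto simp: algebra_simps)
qed

section \<open>Lists of layer lengths always admit a strict improvement\<close>

definition prob_list :: "real list \<Rightarrow> bool" where
  "prob_list p \<longleftrightarrow> (\<forall>x\<in>set p. 0 < x) \<and> sum_list p = 1"

lemma layer_poly_pair_not_maximal:
  assumes "prob_list p"
  shows "\<exists>q. prob_list q \<and> layer_poly [n, 1] p < layer_poly [n, 1] q"
proof -
  have "p \<noteq> []" using assms by (auto simp: prob_list_def)
  then obtain u b where p: "p = u @ [b]" by (metis append_butlast_last_id)
  let ?q = "u @ [b / 2, b / 2]"
  have "prob_list ?q" "0 < b" using assms by (auto simp: p prob_list_def)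
  then show ?thesis
    unfolding p by (intro exI[of _ ?q] conjI) (simp_all only: layer_poly_snoc_pair, simp)
qed

lemma layer_poly_not_maximal_Cons:
  assumes ls: "\<forall>i\<in>set (l # ls). 0 < i"
  shows "\<exists>n0. \<forall>n\<ge>n0. \<forall>p. prob_list p \<longrightarrow>
    (\<exists>q. prob_list q \<and> layer_poly (n # 1 # l # ls) p < layer_poly (n # 1 # l # ls) q)"
proof -
  let ?as = "1 # l # ls"
  \<comment> \<open>The comparison list gives 9/10 to the first layer and spreads 1/10 equally over
    \<open>N\<close> further layers, one for each remaining exponent, which makes \<open>c\<close>
    positive.\<close>
  define N where "N = length ?as"
  define v0 where "v0 = replicate N (1 / (10 * real N))"
  define c where "c = layer_poly ?as v0"
  have N: "0 < N" by (simp add: N_def)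
  have c: "0 < c" unfolding c_def v0_def using N by (intro layer_poly_pos) (auto simp: N_def)
  have v0: "prob_list ((9/10) # v0)"
    using N by (auto simp: prob_list_def v0_def sum_list_replicate)
  \<comment> \<open>The first condition excludes lists without a layer of length 8/10. The second is
    for merging, with 72/100 = (8/10)(9/10). The third is for splitting, with all other layers at
    most 2/10. The last makes \<open>n\<close> positive and lets \<open>b ^ Suc l\<close> be
    factored out of \<open>b ^ n\<close>. The factors 10/8 and 10 produce (8/10)^(n-1) and 2
    (2/10)^(n-1).\<close>
  have ev: "eventually (\<lambda>n. (10/8) * (8/10) ^ n < c * (9/10) ^ n \<and> 10 * (2/10) ^ n < c * (72/100) ^ n \<and>
      10 ^ Suc l * (2/10) ^ n < 1 * (8/10 :: real) ^ n \<and> Suc l \<le> n) sequentially"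
    using c by (intro eventually_conj eventually_power_less eventually_ge_at_top) auto
  then obtain n0 where n0: "\<And>n. n \<ge> n0 \<Longrightarrow> (10/8) * (8/10) ^ n < c * (9/10) ^ n \<and> 10 * (2/10) ^ n < c * (72/100) ^ n \<and>
      10 ^ Suc l * (2/10) ^ n < (8/10 :: real) ^ n \<and> Suc l \<le> n"
    unfolding eventually_sequentially by auto
  show ?thesis
  proof (intro exI[of _ n0] allI impI)
    fix n p assume n: "n0 \<le> n" and p: "prob_list p"
    let ?F = "layer_poly (n # ?as)"
    have as: "\<forall>a\<in>set ?as. 0 < a" using ls by auto
    obtain m where m: "n = Suc m" using n0[OF n] by (cases n) auto
    define D where "D = (2/10 :: real) ^ m"
    have n1: "(8/10) ^ m < c * (9/10) ^ n" and n2: "2 * D < c * (72/100) ^ n"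
      and n3: "10 ^ Suc l * (2/10) ^ n < (8/10 :: real) ^ n" and n4: "Suc l \<le> n"
      using n0[OF n] by (auto simp: m D_def)
    have Fstar: "c * (9/10) ^ n \<le> ?F ((9/10) # v0)"
      using layer_poly_nonneg[of v0 "n # ?as"] by (auto simp: c_def v0_def mult.commute)
    show "\<exists>q. prob_list q \<and> ?F p < ?F q"
    \<comment> \<open>A list below the value guaranteed for the comparison list is beaten by that
      list.\<close>
    proof (cases "?F p < c * (9/10) ^ n")
      case True
      then show ?thesis using Fstar v0 by (intro exI[of _ "(9/10) # v0"]) auto
    next
      case False
      then have Fp: "c * (9/10) ^ n \<le> ?F p" by simp
      moreover have "0 < c * (9/10) ^ n" using c by simp
      ultimately have Fpos: "0 < ?F p" by linarith
      have nn: "\<forall>x\<in>set p. 0 \<le> x" and sum: "sum_list p = 1"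
        using p by (auto simp: prob_list_def less_imp_le)
      \<comment> \<open>Otherwise \<open>layer_poly_append_le\<close> bounds the value by the sum of
        the n-th powers, which is at most (8/10)^m.\<close>
      have "\<exists>a\<in>set p. 8/10 \<le> a"
      proof (rule ccontr)
        assume *: "\<not> ?thesis"
        have "?F p \<le> (\<Sum>x\<leftarrow>p. x ^ n)"
          using layer_poly_append_le[of ?as p "[]" n] as nn sum by simp
        also have "\<dots> \<le> (8/10) ^ m"
          using sum_list_power_le[of p "8/10" m] * nn sum m by force
        finally show False using Fp n1 by simp
      qed
      then obtain a u v where a: "8/10 \<le> a" and puv: "p = u @ a # v"
        by (meson split_list)
      have nnu: "\<forall>x\<in>set u. 0 \<le> x" and nnv: "\<forall>x\<in>set v. 0 \<le> x" and sv: "sum_list u + a + sum_list v = 1"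
        using nn sum by (auto simp: puv)
      have su: "0 \<le> sum_list u" "0 \<le> sum_list v" using nnu nnv by (auto intro: sum_list_nonneg)
      have small: "x \<le> 2/10" if "x \<in> set u \<union> set v" for x
        using that sum_list_member_le[OF nnu, of x] sum_list_member_le[OF nnv, of x] su sv a by auto
      let ?W = "layer_poly ?as v"
      have W0: "0 \<le> ?W" using layer_poly_nonneg[OF nnv] .
      \<comment> \<open>Terms with the exponent \<open>n\<close> off \<open>a\<close> total at most
        \<open>D\<close>, so \<open>?W\<close> is at least c (9/10)^n - D. The factor 2 in
        \<open>n2\<close> leaves more than \<open>D\<close> after multiplication by (8/10)^n, a
        lower bound for \<open>a ^ m\<close>.\<close>
      have gain: "D < a ^ m * ?W"
      proof -
        have "?F p \<le> (\<Sum>x\<leftarrow>u. x ^ n) + ?F (a # v)"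
          unfolding puv using as nn sum by (intro layer_poly_append_le) (auto simp: puv)
        also have "?F (a # v) = a ^ n * ?W + ?F v" by simp
        also have "?F v \<le> (\<Sum>x\<leftarrow>v. x ^ n)"
          using layer_poly_append_le[of ?as v "[]" n] as nnv su sv a by simp
        also have "(\<Sum>x\<leftarrow>v. x ^ n) \<le> D * sum_list v"
          unfolding D_def m using small nnv by (intro sum_list_power_le) auto
        also have "(\<Sum>x\<leftarrow>u. x ^ n) \<le> D * sum_list u"
          unfolding D_def m using small nnu by (intro sum_list_power_le) auto
        finally have "?F p \<le> D * (sum_list u + sum_list v) + a ^ n * ?W"
          by (simp add: algebra_simps)
        also have "D * (sum_list u + sum_list v) \<le> D"
          using sv a by (intro mult_left_le) (auto simp: D_def)
        also have "a ^ n * ?W \<le> ?W"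
          using W0 a su sv by (intro mult_left_le_one_le) (auto intro: power_le_one)
        finally have *: "c * (9/10) ^ n - D \<le> ?W" using Fp by simp
        have D: "0 \<le> D" by (simp add: D_def)
        have eq: "c * (72/100) ^ n = (8/10) ^ n * (c * (9/10) ^ n)"
          by (simp flip: power_mult_distrib)
        have "(8/10) ^ n * D \<le> D" using D by (intro mult_left_le_one_le) (auto intro: power_le_one)
        then have "D < (8/10) ^ n * (c * (9/10) ^ n - D)"
          using n2 unfolding eq right_diff_distrib by linarith
        also have "\<dots> \<le> (8/10) ^ n * ?W" using * by (intro mult_left_mono) auto
        also have "\<dots> \<le> a ^ m * ?W"
        proof (rule mult_right_mono[OF _ W0])
          have "(8/10) ^ n \<le> (8/10 :: real) ^ m" unfolding m by simp
          also have "\<dots> \<le> a ^ m" using a by (intro power_mono) auto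
          finally show "(8/10) ^ n \<le> a ^ m" .
        qed
        finally show ?thesis .
      qed
      show ?thesis
      \<comment> \<open>Mass in front of the large layer is merged into it; if there is none, the
        second layer is split.\<close>
      proof (cases u)
        case (Cons y u')
        have u_pos: "0 < sum_list u" using p nnu Cons
          by (auto simp: prob_list_def puv intro!: add_pos_nonneg sum_list_nonneg)
        have "?F p < ?F ((sum_list u + a) # v)"
          unfolding puv m
          by (rule layer_poly_merge_less[where t = "2/10"])
             (use as nn sum small u_pos gain in \<open>auto simp: puv D_def\<close>)
        moreover have "prob_list ((sum_list u + a) # v)"
          using p su by (auto simp: prob_list_def puv intro: add_nonneg_pos)
        ultimately show ?thesis by blast
      next
        case Nil
        have "0 \<le> D" by (simp add: D_def)
        \<comment> \<open>On an empty \<open>v\<close> the polynomial \<open>?W\<close> would be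
          zero.\<close>
        then have "v \<noteq> []" using gain by (intro notI) simp
        then obtain b w where v: "v = b # w" by (cases v) auto
        have b: "0 < b" "b \<le> 2/10" using p small by (auto simp: puv v prob_list_def)
        \<comment> \<open>With n = l + 1 + j, dividing by (b/2)^(l+1) reduces this to 2^(l+1) b^j <
          a^n, which follows from \<open>n3\<close> since b <= 2/10 and a >= 8/10.\<close>
        have "b ^ n < a ^ n * (b / 2) ^ Suc l"
        proof -
          obtain j where j: "n = Suc l + j" using n4 le_iff_add by blast
          have "b ^ j \<le> (2/10) ^ j" using b by (intro power_mono) auto
          moreover have "2 ^ Suc l * (2/10) ^ j < a ^ n"
          proof -
            have e: "10 ^ Suc l * (2/10 :: real) ^ n = 2 ^ Suc l * (2/10) ^ j"
              unfolding j power_add by (simp flip: power_mult_distrib mult.assoc)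
            have "(8/10) ^ n \<le> a ^ n" using a by (intro power_mono) auto
            then show ?thesis using n3 unfolding e by simp
          qed
          ultimately have "2 ^ Suc l * b ^ j < a ^ n"
            by (smt (verit) mult_left_mono zero_le_power)
          then have "2 ^ Suc l * b ^ j * (b / 2) ^ Suc l < a ^ n * (b / 2) ^ Suc l"
            using b by (intro mult_strict_right_mono) auto
          moreover have "2 ^ Suc l * b ^ j * (b / 2) ^ Suc l = b ^ n"
            unfolding j power_add power_divide by simp
          ultimately show ?thesis by simp
        qed
        then have "?F p < ?F (a # b / 2 # b / 2 # w)"
          unfolding puv v Nil append_Nil
          using ls nnv sv su a b Fpos
          by (intro layer_poly_split_less) (auto simp: v puv Nil simp del: pattern_sum.simps)
        moreover have "prob_list (a # b / 2 # b / 2 # w)"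
          using p by (auto simp: prob_list_def puv v Nil)
        ultimately show ?thesis by blast
      qed
    qed
  qed
qed

lemma layer_poly_not_maximal:
  assumes "\<forall>l\<in>set ls. 0 < l"
  shows "\<exists>n0. \<forall>n\<ge>n0. \<forall>p. prob_list p \<longrightarrow>
    (\<exists>q. prob_list q \<and> layer_poly (n # 1 # ls) p < layer_poly (n # 1 # ls) q)"
proof (cases ls)
  case Nil
  then show ?thesis using layer_poly_pair_not_maximal by blast
next
  case (Cons l ls')
  then show ?thesis using layer_poly_not_maximal_Cons assms by blast
qed

subsection \<open>Layered permutations and the packing density\<close>

text \<open>Indices count from 0, positions from 1. Positions beyond \<open>sum_list as\<close> get
  the index \<open>length as\<close>, as if one further layer followed.\<close>

fun layer_index :: "nat list \<Rightarrow> nat \<Rightarrow> nat" where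
  "layer_index [] x = 0"
| "layer_index (a # as) x = (if x \<le> a then 0 else Suc (layer_index as (x - a)))"

lemma layer_index_mono: "x \<le> y \<Longrightarrow> layer_index as x \<le> layer_index as y"
proof (induction as arbitrary: x y)
  case (Cons a as)
  show ?case using Cons.prems Cons.IH[of "x - a" "y - a"] by auto
qed simp

lemma layer_index_less_length: "x \<le> sum_list as \<Longrightarrow> as \<noteq> [] \<Longrightarrow> layer_index as x < length as"
proof (induction as arbitrary: x)
  case (Cons a as)
  then show ?case by (cases "as = []") auto
qed simp

lemma mem_layer_interval_layer_index:
  "0 < x \<Longrightarrow> x \<le> sum_list as \<Longrightarrow> x \<in> layer_interval as (layer_index as x)"
proof (induction as arbitrary: x)
  case (Cons a as)
  then show ?case
  proof (cases "x \<le> a")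
    case False
    then have "x - a \<in> layer_interval as (layer_index as (x - a))"
      using Cons.prems by (intro Cons.IH) auto
    then show ?thesis using False by (auto simp: layer_interval_def)
  qed (simp add: layer_interval_def)
qed simp

text \<open>Besides bijectivity, this is the only consequence of layeredness in use: the relative
  order of two values is read off from the layer indices.\<close>

lemma layered_perm_less_iff:
  assumes "layered_perm as \<sigma>" "0 < x" "x < y" "y \<le> sum_list as"
  shows "\<sigma> x < \<sigma> y \<longleftrightarrow> layer_index as x \<noteq> layer_index as y"
proof -
  have ne: "as \<noteq> []" using assms by auto
  have mem: "x \<in> layer_interval as (layer_index as x)" "y \<in> layer_interval as (layer_index as y)"
    using assms by (auto intro: mem_layer_interval_layer_index)
  have len: "layer_index as y < length as" using assms ne by (intro layer_index_less_length)
  have le: "layer_index as x \<le> layer_index as y" using assms by (intro layer_index_mono) auto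
  show ?thesis
  proof (cases "layer_index as x = layer_index as y")
    case True
    then have "\<sigma> y < \<sigma> x" using assms mem len unfolding layered_perm_def by metis
    then show ?thesis using True by simp
  next
    case False
    then have "layer_index as x < layer_index as y" using le by simp
    then have "\<sigma> x < \<sigma> y" using assms(1) mem len unfolding layered_perm_def by blast
    then show ?thesis using False by simp
  qed
qed

text \<open>The value at \<open>x\<close> is the rank of \<open>f x\<close>. Permutations can thus
  be specified by arbitrary injective keys.\<close>

lemma standardization:
  fixes f :: "nat \<Rightarrow> nat"
  assumes inj: "inj_on f {1..n}"
  obtains \<pi> where "\<pi> permutes {1..n}"
    "\<And>x y. x \<in> {1..n} \<Longrightarrow> y \<in> {1..n} \<Longrightarrow> \<pi> x < \<pi> y \<longleftrightarrow> f x < f y"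
proof
  define r where "r x = card {y\<in>{1..n}. f y \<le> f x}" for x
  let ?\<pi> = "\<lambda>x. if x \<in> {1..n} then r x else x"
  have mono: "r x < r y" if "y \<in> {1..n}" "f x < f y" for x y
  proof -
    have "y \<in> {z\<in>{1..n}. f z \<le> f y} - {z\<in>{1..n}. f z \<le> f x}" using that by simp
    moreover have "{z\<in>{1..n}. f z \<le> f x} \<subseteq> {z\<in>{1..n}. f z \<le> f y}" using that(2) by auto
    ultimately have "{z\<in>{1..n}. f z \<le> f x} \<subset> {z\<in>{1..n}. f z \<le> f y}" by blast
    then show ?thesis unfolding r_def by (intro psubset_card_mono) auto
  qed
  have iff: "r x < r y \<longleftrightarrow> f x < f y" if "x \<in> {1..n}" "y \<in> {1..n}" for x y
    using mono[of y x] mono[of x y] that inj_onD[OF inj, of x y]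
    by (cases "f x" "f y" rule: linorder_cases) auto
  then show "?\<pi> x < ?\<pi> y \<longleftrightarrow> f x < f y" if "x \<in> {1..n}" "y \<in> {1..n}" for x y
    using that by simp
  have inj': "inj_on r {1..n}"
    by (rule inj_onI) (metis inj inj_onD linorder_neqE_nat less_irrefl mono)
  have "r x \<in> {1..n}" if "x \<in> {1..n}" for x
  proof -
    have "r x \<le> card {1..n}" unfolding r_def by (intro card_mono) auto
    moreover have "r x \<noteq> 0" using that by (auto simp: r_def)
    ultimately show ?thesis by simp
  qed
  then have "r ` {1..n} = {1..n}" using inj' by (intro endo_inj_surj) auto
  then have "bij_betw r {1..n} {1..n}" using inj' by (simp add: bij_betw_def)
  then have "bij_betw ?\<pi> {1..n} {1..n}" by (subst bij_betw_cong[where g = r]) auto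
  then show "?\<pi> permutes {1..n}" by (intro bij_imp_permutes) auto
qed

section \<open>Monotonicity and convergence of the maximal density\<close>

definition induced_sets :: "nat \<Rightarrow> (nat \<Rightarrow> nat) \<Rightarrow> nat \<Rightarrow> (nat \<Rightarrow> nat) \<Rightarrow> nat set set" where
  "induced_sets m \<sigma> n \<pi> = {S. S \<subseteq> {1..n} \<and> card S = m \<and> induces m \<sigma> \<pi> S}"

lemma perm_density_eq: "perm_density m \<sigma> n \<pi> = real (card (induced_sets m \<sigma> n \<pi>)) / real (n choose m)"
  by (simp add: perm_density_def induced_sets_def)

lemma finite_induced_sets: "finite (induced_sets m \<sigma> n \<pi>)"
  by (rule finite_subset[of _ "Pow {1..n}"]) (auto simp: induced_sets_def)

definition max_density :: "nat \<Rightarrow> (nat \<Rightarrow> nat) \<Rightarrow> nat \<Rightarrow> real" where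
  "max_density m \<sigma> n = Max {perm_density m \<sigma> n \<pi> | \<pi>. \<pi> permutes {1..n}}"

lemma
  shows perm_density_le_max: "\<pi> permutes {1..n} \<Longrightarrow> perm_density m \<sigma> n \<pi> \<le> max_density m \<sigma> n"
    and max_density_attained: "\<exists>\<pi>. \<pi> permutes {1..n} \<and> max_density m \<sigma> n = perm_density m \<sigma> n \<pi>"
proof -
  let ?A = "{perm_density m \<sigma> n \<pi> | \<pi>. \<pi> permutes {1..n}}"
  have fin: "finite ?A" using finite_permutations[of "{1..n}"] by simp
  have ne: "?A \<noteq> {}" using permutes_id by blast
  show "\<pi> permutes {1..n} \<Longrightarrow> perm_density m \<sigma> n \<pi> \<le> max_density m \<sigma> n"
    unfolding max_density_def by (intro Max_ge fin) auto
  show "\<exists>\<pi>. \<pi> permutes {1..n} \<and> max_density m \<sigma> n = perm_density m \<sigma> n \<pi>"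
    using Max_in[OF fin ne] unfolding max_density_def by auto
qed

text \<open>Delete the position \<open>v\<close> from \<open>\<pi>\<close> and standardize; the
  copies avoiding \<open>v\<close> survive. The map \<open>skip\<close> enumerates the positions
  other than \<open>v\<close> in increasing order, and \<open>unskip\<close> inverts it
  there.\<close>

lemma card_induced_sets_avoiding_le:
  assumes \<pi>: "\<pi> permutes {1..Suc n}" and v: "v \<in> {1..Suc n}"
  obtains \<pi>' where "\<pi>' permutes {1..n}"
    "card {S\<in>induced_sets m \<sigma> (Suc n) \<pi>. v \<notin> S} \<le> card (induced_sets m \<sigma> n \<pi>')"
proof -
  define skip where "skip x = (if x < v then x else Suc x)" for x
  define unskip where "unskip x = (if x < v then x else x - 1)" for x
  have su: "skip (unskip x) = x" if "x \<noteq> v" for x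
    using that by (auto simp: skip_def unskip_def)
  have un: "unskip x \<in> {1..n}" if "x \<in> {1..Suc n}" "x \<noteq> v" for x
    using that v by (auto simp: unskip_def)
  have us: "unskip x < unskip y" if "x < y" "x \<noteq> v" "y \<noteq> v" for x y
    using that by (auto simp: unskip_def)
  have inj: "inj_on skip A" for A by (auto simp: inj_on_def skip_def split: if_splits)
  have "inj_on (\<pi> \<circ> skip) {1..n}"
    using permutes_inj_on[OF \<pi>] inj by (intro comp_inj_on) auto
  then obtain \<pi>' where \<pi>': "\<pi>' permutes {1..n}"
    and less: "\<And>x y. x \<in> {1..n} \<Longrightarrow> y \<in> {1..n} \<Longrightarrow> \<pi>' x < \<pi>' y \<longleftrightarrow> \<pi> (skip x) < \<pi> (skip y)"
    using standardization[of "\<pi> \<circ> skip" n] unfolding comp_def by blast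
  have "{S\<in>induced_sets m \<sigma> (Suc n) \<pi>. v \<notin> S} \<subseteq> (`) skip ` induced_sets m \<sigma> n \<pi>'"
  proof
    fix S assume "S \<in> {S\<in>induced_sets m \<sigma> (Suc n) \<pi>. v \<notin> S}"
    then have S: "S \<subseteq> {1..Suc n}" "card S = m" "induces m \<sigma> \<pi> S" "v \<notin> S"
      by (auto simp: induced_sets_def)
    from S(3) obtain e where e: "strict_mono_on {1..m} e" "e ` {1..m} = S"
      and e_less: "\<forall>i\<in>{1..m}. \<forall>j\<in>{1..m}. \<sigma> i < \<sigma> j \<longleftrightarrow> \<pi> (e i) < \<pi> (e j)"
      unfolding induces_def by blast
    have e_in: "e i \<in> {1..Suc n}" "e i \<noteq> v" if "i \<in> {1..m}" for i
    proof -
      have "e i \<in> S" using that e(2) by blast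
      then show "e i \<in> {1..Suc n}" "e i \<noteq> v" using S(1,4) by blast+
    qed
    let ?S' = "unskip ` S"
    have "skip ` ?S' = S"
    proof -
      have "(\<lambda>x. skip (unskip x)) ` S = (\<lambda>x. x) ` S" using S(4) by (intro image_cong refl su) blast
      then show ?thesis by (simp add: image_image)
    qed
    moreover have "?S' \<in> induced_sets m \<sigma> n \<pi>'"
      unfolding induced_sets_def mem_Collect_eq induces_def
    proof (intro conjI exI[of _ "unskip \<circ> e"])
      show "?S' \<subseteq> {1..n}" using S un by blast
      show "card ?S' = m" using S(2) \<open>skip ` ?S' = S\<close> card_image[OF inj, of ?S'] by simp
      show "strict_mono_on {1..m} (unskip \<circ> e)"
        using e(1) e_in us by (auto simp: strict_mono_on_def)
      show "(unskip \<circ> e) ` {1..m} = ?S'" unfolding e(2)[symmetric] by (rule image_comp[symmetric])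
      show "\<forall>i\<in>{1..m}. \<forall>j\<in>{1..m}. \<sigma> i < \<sigma> j \<longleftrightarrow> \<pi>' ((unskip \<circ> e) i) < \<pi>' ((unskip \<circ> e) j)"
        using e_less e_in un su less by simp
    qed
    ultimately show "S \<in> (`) skip ` induced_sets m \<sigma> n \<pi>'" by (metis imageI)
  qed
  then have "card {S\<in>induced_sets m \<sigma> (Suc n) \<pi>. v \<notin> S} \<le> card (induced_sets m \<sigma> n \<pi>')"
    by (rule surj_card_le[OF finite_induced_sets])
  then show ?thesis using that \<pi>' by blast
qed

text \<open>Double counting of pairs of a copy and a position outside it: each copy misses n + 1 - m
  positions, and each position is missed by at most the maximal number of copies at order n. Then
  use (n + 1) C(n, m) = (n + 1 - m) C(n + 1, m).\<close>

lemma max_density_Suc_le: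
  assumes "m \<le> n"
  shows "max_density m \<sigma> (Suc n) \<le> max_density m \<sigma> n"
proof -
  obtain \<pi> where \<pi>: "\<pi> permutes {1..Suc n}" and max: "max_density m \<sigma> (Suc n) = perm_density m \<sigma> (Suc n) \<pi>"
    using max_density_attained by blast
  let ?S = "induced_sets m \<sigma> (Suc n) \<pi>"
  let ?M = "max_density m \<sigma> n * real (n choose m)"
  have "(\<Sum>v\<in>{1..Suc n}. card {S\<in>?S. v \<notin> S}) = (Suc n - m) * card ?S"
  proof (rule sum_multicount[OF finite_atLeastAtMost finite_induced_sets], rule ballI)
    fix S assume "S \<in> ?S"
    then have S: "S \<subseteq> {1..Suc n}" "card S = m" by (auto simp: induced_sets_def)
    have "{v\<in>{1..Suc n}. v \<notin> S} = {1..Suc n} - S" by auto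
    then show "card {v\<in>{1..Suc n}. v \<notin> S} = Suc n - m"
      using S by (simp add: card_Diff_subset finite_subset[OF S(1)])
  qed
  then have "real (Suc n - m) * real (card ?S) = (\<Sum>v\<in>{1..Suc n}. real (card {S\<in>?S. v \<notin> S}))"
    unfolding of_nat_mult[symmetric] of_nat_sum[symmetric] by (simp only:)
  also have "\<dots> \<le> (\<Sum>v\<in>{1..Suc n}. ?M)"
  proof (rule sum_mono)
    fix v assume "v \<in> {1..Suc n}"
    then obtain \<pi>' where \<pi>': "\<pi>' permutes {1..n}"
      and le: "card {S\<in>?S. v \<notin> S} \<le> card (induced_sets m \<sigma> n \<pi>')"
      using card_induced_sets_avoiding_le[OF \<pi>] by blast
    have "real (card (induced_sets m \<sigma> n \<pi>')) \<le> ?M"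
      using perm_density_le_max[OF \<pi>', of m \<sigma>] assms by (simp add: perm_density_eq field_simps)
    then show "real (card {S\<in>?S. v \<notin> S}) \<le> ?M" using le by linarith
  qed
  also have "\<dots> = max_density m \<sigma> n * real (Suc n * (n choose m))" by (simp add: algebra_simps)
  also have "Suc n * (n choose m) = (Suc n - m) * (Suc n choose m)"
    using binomial_absorb_comp[of "Suc n" m] by simp
  finally have "real (Suc n - m) * real (card ?S) \<le> real (Suc n - m) * (max_density m \<sigma> n * real (Suc n choose m))"
    by (simp add: mult_ac)
  then have "real (card ?S) \<le> max_density m \<sigma> n * real (Suc n choose m)"
    using assms by (subst (asm) mult_le_cancel_left_pos) auto
  then show ?thesis unfolding max perm_density_eq using assms by (simp add: divide_le_eq)
qed

text \<open>The sequence is nonnegative and decreasing from index \<open>m\<close> on, so the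
  \<open>lim\<close> in \<open>packing_density\<close> is a genuine limit.\<close>

lemma max_density_tendsto: "max_density m \<sigma> \<longlonglongrightarrow> packing_density m \<sigma>"
proof -
  let ?X = "\<lambda>n. max_density m \<sigma> (n + m)"
  have "decseq ?X" by (intro decseq_SucI) (simp add: max_density_Suc_le)
  moreover have "0 \<le> ?X n" for n
    using max_density_attained[of "n + m" m \<sigma>] by (auto simp: perm_density_def)
  ultimately obtain L where "?X \<longlonglongrightarrow> L" using decseq_convergent[of ?X 0] by metis
  then have "max_density m \<sigma> \<longlonglongrightarrow> L" by (rule LIMSEQ_offset)
  then show ?thesis unfolding packing_density_def max_density_def[symmetric] by (simp add: limI)
qed

section \<open>Copies of a layered pattern in a layered permutation\<close>

fun pattern_sets :: "nat list \<Rightarrow> 'a set list \<Rightarrow> 'a set set" where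
  "pattern_sets [] Bs = {{}}"
| "pattern_sets (a # as) [] = {}"
| "pattern_sets (a # as) (B # Bs) =
     (\<lambda>(U, V). U \<union> V) ` ({U. U \<subseteq> B \<and> card U = a} \<times> pattern_sets as Bs) \<union> pattern_sets (a # as) Bs"

definition ordered_blocks :: "nat set list \<Rightarrow> bool" where
  "ordered_blocks Bs \<longleftrightarrow> sorted_wrt (\<lambda>A B. \<forall>x\<in>A. \<forall>y\<in>B. x < y) Bs \<and> (\<forall>B\<in>set Bs. finite B)"

lemma pattern_sets_subset: "S \<in> pattern_sets as Bs \<Longrightarrow> S \<subseteq> \<Union>(set Bs)"
proof (induction as Bs arbitrary: S rule: pattern_sets.induct)
  case (3 a as B Bs)
  then consider "S \<in> pattern_sets (a # as) Bs" | U V where "S = U \<union> V" "U \<subseteq> B" "V \<in> pattern_sets as Bs"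
    by auto
  then show ?case
  proof cases
    case 1
    then show ?thesis using 3(2)[OF 1] by auto
  next
    case 2
    then show ?thesis using 3(1)[OF 2(3)] by auto
  qed
qed auto

lemma finite_pattern_sets: "\<forall>B\<in>set Bs. finite B \<Longrightarrow> finite (pattern_sets as Bs)"
  by (induction as Bs rule: pattern_sets.induct) (auto intro!: finite_imageI finite_cartesian_product)

text \<open>\<open>pattern_sets\<close> is the set-level counterpart of \<open>pattern_sum\<close>.
  The union in its recursion is disjoint, since a set of the first kind has a > 0 elements in
  \<open>B\<close> and one of the second kind has none. Intersecting with \<open>B\<close> recovers
  the part chosen there.\<close>

lemma card_pattern_sets:
  assumes "ordered_blocks Bs" "\<forall>a\<in>set as. 0 < a"
  shows "card (pattern_sets as Bs) = pattern_sum (\<lambda>B a. card B choose a) as Bs"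
  using assms
proof (induction as Bs rule: pattern_sets.induct)
  case (3 a as B Bs)
  let ?P = "{U. U \<subseteq> B \<and> card U = a} \<times> pattern_sets as Bs"
  have fin: "finite B" "\<forall>B\<in>set Bs. finite B" and ord: "ordered_blocks Bs" "\<And>x y. x \<in> B \<Longrightarrow> y \<in> \<Union>(set Bs) \<Longrightarrow> x < y"
    using 3 by (auto simp: ordered_blocks_def)
  have disj: "B \<inter> \<Union>(set Bs) = {}" using ord(2) by blast
  have rec: "(U \<union> V) \<inter> B = U \<and> (U \<union> V) - B = V" if "(U, V) \<in> ?P" for U V
    using that pattern_sets_subset[of V as Bs] disj by auto
  have inj: "inj_on (\<lambda>(U, V). U \<union> V) ?P"
  proof (rule inj_onI)
    fix p q assume pq: "p \<in> ?P" "q \<in> ?P" "(\<lambda>(U, V). U \<union> V) p = (\<lambda>(U, V). U \<union> V) q"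
    obtain U V U' V' where UV: "p = (U, V)" "q = (U', V')" by (cases p, cases q)
    have eq: "U \<union> V = U' \<union> V'" using pq(3) unfolding UV by simp
    have "(U \<union> V) \<inter> B = U" "(U \<union> V) - B = V" using rec pq(1) unfolding UV by blast+
    moreover have "(U' \<union> V') \<inter> B = U'" "(U' \<union> V') - B = V'" using rec pq(2) unfolding UV by blast+
    ultimately show "p = q" unfolding UV eq by simp
  qed
  have dj: "(\<lambda>(U, V). U \<union> V) ` ?P \<inter> pattern_sets (a # as) Bs = {}"
  proof (rule ccontr)
    assume "\<not> ?thesis"
    then obtain U V where UV: "(U, V) \<in> ?P" "U \<union> V \<in> pattern_sets (a # as) Bs" by auto
    then have "U \<subseteq> B \<inter> \<Union>(set Bs)" using pattern_sets_subset by fast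
    then have "U = {}" using disj by simp
    then show False using UV 3 by auto
  qed
  have "finite {U. U \<subseteq> B \<and> card U = a}" using fin by simp
  then have "card (pattern_sets (a # as) (B # Bs)) = card ?P + card (pattern_sets (a # as) Bs)"
    using fin finite_pattern_sets[OF fin(2)] inj dj
    by (simp add: card_Un_disjoint card_image finite_imageI finite_cartesian_product)
  also have "card ?P = (card B choose a) * card (pattern_sets as Bs)"
    using fin by (simp add: card_cartesian_product n_subsets)
  finally show ?case using 3 ord(1) by simp
qed auto

lemma finite_set_enum:
  fixes S :: "nat set"
  assumes "finite S"
  obtains e where "strict_mono_on {1..card S} e" "e ` {1..card S} = S"
proof
  let ?l = "sorted_list_of_set S"
  let ?e = "\<lambda>i. ?l ! (i - 1)"
  show "strict_mono_on {1..card S} ?e"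
    by (auto simp: strict_mono_on_def intro!: sorted_wrt_nth_less[OF strict_sorted_list_of_set] diff_less_mono)
  have "?e ` {1..card S} = (!) ?l ` {..<card S}"
  proof -
    have "(\<lambda>i. i - 1) ` {1..card S} = {..<card S}"
      by (auto simp: image_iff intro!: bexI[of _ "Suc _"])
    then show ?thesis by (metis image_image)
  qed
  also have "\<dots> = S" using assms nth_image[of "card S" ?l] by (simp add: lessThan_atLeast0)
  finally show "?e ` {1..card S} = S" .
qed

definition same_block :: "nat set list \<Rightarrow> nat \<Rightarrow> nat \<Rightarrow> bool" where
  "same_block Bs x y \<longleftrightarrow> (\<exists>B\<in>set Bs. x \<in> B \<and> y \<in> B)"

text \<open>The increasing enumeration of a selected set carries layers of the pattern to blocks. It
  is glued from an enumeration of the part in \<open>B\<close> and that of the rest, shifted by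
  \<open>a\<close>.\<close>

lemma pattern_sets_enum:
  assumes "ordered_blocks Bs" "S \<in> pattern_sets as Bs"
  shows "\<exists>e. strict_mono_on {1..sum_list as} e \<and> e ` {1..sum_list as} = S \<and>
    (\<forall>x\<in>{1..sum_list as}. \<forall>y\<in>{1..sum_list as}.
      layer_index as x = layer_index as y \<longleftrightarrow> same_block Bs (e x) (e y))"
  using assms
proof (induction as Bs arbitrary: S rule: pattern_sets.induct)
  case (3 a as B Bs)
  have fin: "finite B" and ord: "ordered_blocks Bs" "\<And>x y. x \<in> B \<Longrightarrow> y \<in> \<Union>(set Bs) \<Longrightarrow> x < y"
    using 3 by (auto simp: ordered_blocks_def)
  have notB: "y \<notin> B" if "y \<in> \<Union>(set Bs)" for y using ord(2)[of y y] that by blast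
  have sb: "same_block (B # Bs) x y \<longleftrightarrow> same_block Bs x y" if "x \<in> \<Union>(set Bs) \<or> y \<in> \<Union>(set Bs)" for x y
    using that notB by (auto simp: same_block_def)
  show ?case
  proof (cases "S \<in> pattern_sets (a # as) Bs")
    case True
    have SB: "S \<subseteq> \<Union>(set Bs)" by (rule pattern_sets_subset[OF True])
    obtain e where e: "strict_mono_on {1..sum_list (a # as)} e" "e ` {1..sum_list (a # as)} = S"
      "\<forall>x\<in>{1..sum_list (a # as)}. \<forall>y\<in>{1..sum_list (a # as)}.
      layer_index (a # as) x = layer_index (a # as) y \<longleftrightarrow> same_block Bs (e x) (e y)"
      using 3(2)[OF ord(1) True] by blast
    have "same_block (B # Bs) (e x) (e y) \<longleftrightarrow> same_block Bs (e x) (e y)" if "x \<in> {1..sum_list (a # as)}" for x y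
      using that e(2) SB by (intro sb) blast
    then show ?thesis using e by (intro exI[of _ e]) simp
  next
    case False
    then obtain U V where S: "S = U \<union> V" "U \<subseteq> B" "card U = a" "V \<in> pattern_sets as Bs"
      using 3(4) by auto
    have VB: "V \<subseteq> \<Union>(set Bs)" by (rule pattern_sets_subset[OF S(4)])
    obtain g where g: "strict_mono_on {1..a} g" "g ` {1..a} = U"
      using finite_set_enum[OF finite_subset[OF S(2) fin]] S(3) by auto
    let ?m = "sum_list as"
    obtain e where e: "strict_mono_on {1..?m} e" "e ` {1..?m} = V"
      "\<And>x y. x \<in> {1..?m} \<Longrightarrow> y \<in> {1..?m} \<Longrightarrow> layer_index as x = layer_index as y \<longleftrightarrow> same_block Bs (e x) (e y)"
      using 3(1)[OF ord(1) S(4)] by blast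
    let ?e = "\<lambda>x. if x \<le> a then g x else e (x - a)"
    have gB: "g x \<in> B" if "x \<in> {1..a}" for x using that g(2) S(2) by blast
    have eB: "e x \<in> \<Union>(set Bs)" if "x \<in> {1..?m}" for x using that e(2) VB by blast
    show ?thesis
    proof (intro exI[of _ ?e] conjI ballI)
      show "strict_mono_on {1..sum_list (a # as)} ?e"
      proof (rule strict_mono_onI)
        fix x y assume xy: "x \<in> {1..sum_list (a # as)}" "y \<in> {1..sum_list (a # as)}" "x < y"
        show "?e x < ?e y"
        proof (cases "x \<le> a \<and> \<not> y \<le> a")
          case True
          then have "x \<in> {1..a}" "y - a \<in> {1..?m}" using xy by auto
          then show ?thesis using True gB eB ord(2) by simp
        next
          case False
          then show ?thesis
            using strict_mono_onD[OF g(1), of x y] strict_mono_onD[OF e(1), of "x - a" "y - a"] xy by auto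
        qed
      qed
      have "{1..sum_list (a # as)} = {1..a} \<union> (\<lambda>x. x + a) ` {1..?m}"
        by (auto simp: image_iff intro!: bexI[of _ "_ - a"])
      moreover have "?e ` {1..a} = U" using g(2) by (auto simp: image_iff)
      moreover have "?e ` (\<lambda>x. x + a) ` {1..?m} = V"
        unfolding e(2)[symmetric] image_image by (intro image_cong) auto
      ultimately show "?e ` {1..sum_list (a # as)} = S" unfolding S(1) by (simp only: image_Un)
      fix x y assume xy: "x \<in> {1..sum_list (a # as)}" "y \<in> {1..sum_list (a # as)}"
      show "layer_index (a # as) x = layer_index (a # as) y \<longleftrightarrow> same_block (B # Bs) (?e x) (?e y)"
      proof (cases "x \<le> a")
        case x: True
        have gx: "g x \<in> B" using gB[of x] x xy by simp
        show ?thesis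
        proof (cases "y \<le> a")
          case True
          then show ?thesis using x gx gB[of y] xy by (auto simp: same_block_def)
        next
          case False
          have ey: "e (y - a) \<in> \<Union>(set Bs)" using False xy by (intro eB) auto
          have "\<not> same_block (B # Bs) (g x) (e (y - a))"
            using ey gx notB[of "g x"] by (subst sb) (auto simp: same_block_def)
          then show ?thesis using x False by simp
        qed
      next
        case x: False
        have ex: "e (x - a) \<in> \<Union>(set Bs)" using x xy by (intro eB) auto
        show ?thesis
        proof (cases "y \<le> a")
          case True
          have gy: "g y \<in> B" using gB[of y] True xy by simp
          have "\<not> same_block (B # Bs) (e (x - a)) (g y)"
            using ex gy notB[of "g y"] by (subst sb) (auto simp: same_block_def)
          then show ?thesis using x True by simp
        next
          case False
          have "same_block (B # Bs) (e (x - a)) (e (y - a)) \<longleftrightarrow> same_block Bs (e (x - a)) (e (y - a))"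
            using ex by (intro sb) simp
          moreover have "x - a \<in> {1..?m}" "y - a \<in> {1..?m}" using xy x False by auto
          ultimately show ?thesis using e(3)[of "x - a" "y - a"] x False by simp
        qed
      qed
    qed
  qed
qed auto

fun blocks :: "nat \<Rightarrow> nat list \<Rightarrow> nat set list" where
  "blocks s [] = []"
| "blocks s (x # c) = {s<..s + x} # blocks (s + x) c"

lemma Union_blocks: "\<Union>(set (blocks s c)) = {s<..s + sum_list c}"
  by (induction s c rule: blocks.induct) auto

lemma ordered_blocks_blocks: "ordered_blocks (blocks s c)"
proof (induction s c rule: blocks.induct)
  case (2 s x c)
  have "y < z" if "y \<in> {s<..s + x}" "B \<in> set (blocks (s + x) c)" "z \<in> B" for y z B
  proof -
    have "z \<in> {s + x<..s + x + sum_list c}" using that Union_blocks[of "s + x" c] by blast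
    then show ?thesis using that(1) by simp
  qed
  then show ?case using 2 by (auto simp: ordered_blocks_def)
qed (simp add: ordered_blocks_def)

lemma pattern_sum_blocks:
  "pattern_sum (\<lambda>B a. card B choose a) as (blocks s c) = pattern_sum (\<lambda>x a. x choose a) as c"
proof (induction "\<lambda>x a. x choose a :: nat" as c arbitrary: s rule: pattern_sum.induct)
  case (3 a as x c)
  show ?case using 3(1)[of "s + x"] 3(2)[of "s + x"] by simp
qed auto

lemma same_block_blocks:
  assumes "x \<in> {s<..s + sum_list c}" "y \<in> {s<..s + sum_list c}"
  shows "same_block (blocks s c) x y \<longleftrightarrow> layer_index c (x - s) = layer_index c (y - s)"
  using assms
proof (induction s c arbitrary: x y rule: blocks.induct)
  case (2 s z c)
  let ?Bs = "blocks (s + z) c"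
  have unfold: "same_block (blocks s (z # c)) x y \<longleftrightarrow> (x \<in> {s<..s + z} \<and> y \<in> {s<..s + z}) \<or> same_block ?Bs x y"
    by (simp add: same_block_def)
  have gt: "s + z < v" if "B \<in> set ?Bs" "v \<in> B" for v B
  proof -
    have "v \<in> \<Union>(set ?Bs)" using that by blast
    then show ?thesis unfolding Union_blocks by simp
  qed
  have *: "s + z < x \<and> s + z < y" if "same_block ?Bs x y"
    using that gt unfolding same_block_def by blast
  show ?case
  proof (cases "s + z < x \<and> s + z < y")
    case True
    then have "same_block ?Bs x y \<longleftrightarrow> layer_index c (x - (s + z)) = layer_index c (y - (s + z))"
      using 2(2,3) by (intro 2(1)) auto
    moreover have "\<not> x - s \<le> z" "\<not> y - s \<le> z" using True by auto
    ultimately show ?thesis using True unfolding unfold by simp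
  next
    case False
    then have "\<not> same_block ?Bs x y" using * by blast
    then show ?thesis using False 2(2,3) unfolding unfold by auto
  qed
qed simp

text \<open>Take the layered permutation with layer sizes \<open>c\<close>, the leftover positions
  forming one final layer. Every member of \<open>pattern_sets\<close> is then a copy of the
  pattern.\<close>

lemma card_induced_sets_layered_ge:
  assumes \<sigma>: "layered_perm as \<sigma>" and as: "\<forall>a\<in>set as. 0 < a" and c: "sum_list c \<le> n"
  shows "\<exists>\<pi>. \<pi> permutes {1..n} \<and>
    pattern_sum (\<lambda>x a. x choose a) as c \<le> card (induced_sets (sum_list as) \<sigma> n \<pi>)"
proof -
  let ?m = "sum_list as" and ?Bs = "blocks 0 c"
  \<comment> \<open>The key sorts by layer first and by decreasing position within a layer;
    \<open>Suc n\<close> exceeds every n - x, so the layer dominates.\<close>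
  define f where "f x = layer_index c x * Suc n + (n - x)" for x
  have f_less: "f x < f y \<longleftrightarrow> layer_index c x \<noteq> layer_index c y" "f x \<noteq> f y"
    if "x \<in> {1..n}" "y \<in> {1..n}" "x < y" for x y
  proof -
    have "f x < f y" if "layer_index c x < layer_index c y"
    proof -
      have "f x < Suc (layer_index c x) * Suc n" by (simp add: f_def)
      also have "\<dots> \<le> layer_index c y * Suc n" using that by (intro mult_le_mono1) simp
      finally show ?thesis by (simp add: f_def)
    qed
    moreover have "f y < f x" if "layer_index c x = layer_index c y"
      using that \<open>x < y\<close> \<open>y \<in> {1..n}\<close> by (simp add: f_def)
    moreover have "layer_index c x \<le> layer_index c y" using that by (intro layer_index_mono) simp
    ultimately show "f x < f y \<longleftrightarrow> layer_index c x \<noteq> layer_index c y" "f x \<noteq> f y"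
      by (auto simp: le_less)
  qed
  have "inj_on f {1..n}" using f_less(2) by (intro linorder_inj_onI) auto
  then obtain \<pi> where \<pi>: "\<pi> permutes {1..n}" and \<pi>_less:
    "\<And>x y. x \<in> {1..n} \<Longrightarrow> y \<in> {1..n} \<Longrightarrow> \<pi> x < \<pi> y \<longleftrightarrow> f x < f y"
    using standardization by blast
  have "pattern_sets as ?Bs \<subseteq> induced_sets ?m \<sigma> n \<pi>"
  proof
    fix S assume S: "S \<in> pattern_sets as ?Bs"
    have Sn: "S \<subseteq> {0<..sum_list c}" using pattern_sets_subset[OF S] Union_blocks[of 0 c] by simp
    obtain e where e: "strict_mono_on {1..?m} e" "e ` {1..?m} = S"
      and e_iff: "\<And>x y. x \<in> {1..?m} \<Longrightarrow> y \<in> {1..?m} \<Longrightarrow>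
        layer_index as x = layer_index as y \<longleftrightarrow> same_block ?Bs (e x) (e y)"
      using pattern_sets_enum[OF ordered_blocks_blocks S] by blast
    have e_in: "e x \<in> {0<..sum_list c}" "e x \<in> {1..n}" if "x \<in> {1..?m}" for x
    proof -
      show "e x \<in> {0<..sum_list c}" using that e(2) Sn by blast
      then show "e x \<in> {1..n}" using c by simp
    qed
    have lt: "\<sigma> i < \<sigma> j \<longleftrightarrow> \<pi> (e i) < \<pi> (e j)" if ij: "i \<in> {1..?m}" "j \<in> {1..?m}" "i < j" for i j
    proof -
      have "\<sigma> i < \<sigma> j \<longleftrightarrow> layer_index as i \<noteq> layer_index as j"
        using layered_perm_less_iff[OF \<sigma>] ij by simp
      also have "\<dots> \<longleftrightarrow> layer_index c (e i) \<noteq> layer_index c (e j)"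
        using e_iff[OF ij(1,2)] same_block_blocks[of "e i" 0 c "e j"] e_in[OF ij(1)] e_in[OF ij(2)] by simp
      also have "\<dots> \<longleftrightarrow> f (e i) < f (e j)"
        using f_less(1)[of "e i" "e j"] strict_mono_onD[OF e(1) ij] e_in ij by blast
      also have "\<dots> \<longleftrightarrow> \<pi> (e i) < \<pi> (e j)"
        using \<pi>_less e_in ij by blast
      finally show ?thesis .
    qed
    have inj_e: "inj_on e {1..?m}" by (rule strict_mono_on_imp_inj_on[OF e(1)])
    have inj_\<sigma>: "inj \<sigma>" using \<sigma> unfolding layered_perm_def by (blast intro: permutes_inj)
    \<comment> \<open>Injectivity excludes ties, so the comparison of a pair settles the reversed
      pair.\<close>
    have "\<sigma> i < \<sigma> j \<longleftrightarrow> \<pi> (e i) < \<pi> (e j)" if ij: "i \<in> {1..?m}" "j \<in> {1..?m}" for i j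
    proof (cases i j rule: linorder_cases)
      case less
      then show ?thesis using lt ij by blast
    next
      case greater
      then have "\<sigma> j < \<sigma> i \<longleftrightarrow> \<pi> (e j) < \<pi> (e i)" "\<sigma> i \<noteq> \<sigma> j" "\<pi> (e i) \<noteq> \<pi> (e j)"
        using lt[OF ij(2,1)] inj_onD[OF inj_e _ ij] permutes_inj[OF \<pi>] inj_\<sigma> by (auto dest: injD)
      then show ?thesis by auto
    qed simp
    moreover have "card S = ?m" using card_image[OF inj_e] e(2) by simp
    moreover have "S \<subseteq> {1..n}" using Sn c by auto
    ultimately show "S \<in> induced_sets ?m \<sigma> n \<pi>"
      unfolding induced_sets_def induces_def using e by blast
  qed
  then have "card (pattern_sets as ?Bs) \<le> card (induced_sets ?m \<sigma> n \<pi>)"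
    by (rule card_mono[OF finite_induced_sets])
  then show ?thesis
    using \<pi> card_pattern_sets[OF ordered_blocks_blocks as] pattern_sum_blocks by metis
qed

section \<open>Limits of normalized counts of copies\<close>

lemma choose_over_power_tendsto:
  fixes g :: "nat \<Rightarrow> nat"
  assumes "(\<lambda>N. real (g N) / real N) \<longlonglongrightarrow> x"
  shows "(\<lambda>N. real (g N choose a) / real N ^ a) \<longlonglongrightarrow> x ^ a / fact a"
proof (induction a)
  case (Suc a)
  \<comment> \<open>This is (a + 1) C(g, a + 1) = C(g, a) (g - a), divided through by
    N^(a+1).\<close>
  have step: "real (g N choose Suc a) / real N ^ Suc a =
    real (g N choose a) / real N ^ a * ((real (g N) / real N - real a / real N) / real (Suc a))" for N
  proof -
    have "Suc a * (g N choose Suc a) = (g N choose a) * (g N - a)"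
      using binomial_absorption[of a "g N"] binomial_absorb_comp[of "g N" a] by (simp add: mult.commute)
    then have "real (Suc a) * real (g N choose Suc a) = real (g N choose a) * real (g N - a)"
      by (metis of_nat_mult)
    \<comment> \<open>For a > g the binomial coefficient is zero, so truncated subtraction does no
      harm.\<close>
    also have "\<dots> = real (g N choose a) * (real (g N) - real a)"
      by (cases "a \<le> g N") (auto simp: of_nat_diff)
    finally have "real (g N choose Suc a) = real (g N choose a) * (real (g N) - real a) / real (Suc a)"
      by (simp add: field_simps)
    then show ?thesis by (simp add: diff_divide_distrib[symmetric])
  qed
  have "(\<lambda>N. real a / real N) \<longlonglongrightarrow> 0" by (rule lim_const_over_n)
  then have "(\<lambda>N. real (g N choose a) / real N ^ a * ((real (g N) / real N - real a / real N) / real (Suc a)))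
    \<longlonglongrightarrow> x ^ a / fact a * ((x - 0) / real (Suc a))"
    by (intro tendsto_mult tendsto_divide tendsto_diff Suc assms tendsto_const) auto
  then show ?case unfolding step by (simp add: mult_ac)
qed simp

lemma floor_over_tendsto:
  assumes "0 \<le> x"
  shows "(\<lambda>N. real (nat \<lfloor>x * real N\<rfloor>) / real N) \<longlonglongrightarrow> x"
proof (rule tendsto_sandwich)
  have "(\<lambda>N. x - 1 / real N) \<longlonglongrightarrow> x - 0"
    by (intro tendsto_diff tendsto_const lim_const_over_n)
  then show "(\<lambda>N. x - 1 / real N) \<longlonglongrightarrow> x" by simp
  show "eventually (\<lambda>N. x - 1 / real N \<le> real (nat \<lfloor>x * real N\<rfloor>) / real N) sequentially"
    using eventually_gt_at_top[of 0]
  proof eventually_elim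
    case (elim N)
    have "x * real N - 1 \<le> real (nat \<lfloor>x * real N\<rfloor>)" by linarith
    then have "(x * real N - 1) / real N \<le> real (nat \<lfloor>x * real N\<rfloor>) / real N"
      by (intro divide_right_mono) auto
    then show ?case using elim by (simp add: diff_divide_distrib)
  qed
  show "eventually (\<lambda>N. real (nat \<lfloor>x * real N\<rfloor>) / real N \<le> x) sequentially"
    using eventually_gt_at_top[of 0]
  proof eventually_elim
    case (elim N)
    have "real (nat \<lfloor>x * real N\<rfloor>) \<le> x * real N" using assms by simp
    then show ?case using elim by (simp add: field_simps)
  qed
qed simp

text \<open>Every term uses each exponent exactly once. This extracts the factorials and the powers
  of 1/N.\<close>

lemma pattern_sum_scale:
  fixes f :: "'b \<Rightarrow> nat \<Rightarrow> 'c::comm_semiring_1"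
  shows "pattern_sum (\<lambda>x a. f x a * k a) as xs = pattern_sum f as xs * (\<Prod>a\<leftarrow>as. k a)"
  by (induction f as xs rule: pattern_sum.induct) (auto simp: algebra_simps)

lemma pattern_sum_map: "pattern_sum f as (map g xs) = pattern_sum (\<lambda>x. f (g x)) as xs"
  by (induction "\<lambda>x. f (g x)" as xs rule: pattern_sum.induct) auto

lemma of_nat_pattern_sum:
  "of_nat (pattern_sum f as xs) = pattern_sum (\<lambda>x a. of_nat (f x a)) as xs"
  by (induction f as xs rule: pattern_sum.induct) auto

lemma pattern_sum_tendsto:
  fixes f :: "nat \<Rightarrow> 'b \<Rightarrow> nat \<Rightarrow> real"
  assumes "\<And>x a. x \<in> set xs \<Longrightarrow> (\<lambda>N. f N x a) \<longlonglongrightarrow> g x a"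
  shows "(\<lambda>N. pattern_sum (f N) as xs) \<longlonglongrightarrow> pattern_sum g as xs"
  using assms by (induction g as xs rule: pattern_sum.induct) (auto intro!: tendsto_add tendsto_mult)

text \<open>The number of ways to distribute the sampled points among the layers of the
  pattern.\<close>

definition multinomial :: "nat list \<Rightarrow> real" where
  "multinomial as = fact (sum_list as) / (\<Prod>a\<leftarrow>as. fact a)"

text \<open>Count copies in a layered permutation of order N with layer sizes floor(x N) for x in
  \<open>q\<close>, and let N grow.\<close>

lemma layer_poly_le_packing_density:
  assumes \<sigma>: "layered_perm as \<sigma>" and as: "\<forall>a\<in>set as. 0 < a" and q: "prob_list q"
  shows "multinomial as * layer_poly as q \<le> packing_density (sum_list as) \<sigma>"
proof (rule LIMSEQ_le[OF _ max_density_tendsto])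
  let ?m = "sum_list as"
  let ?c = "\<lambda>N. map (\<lambda>x. nat \<lfloor>x * real N\<rfloor>) q"
  \<comment> \<open>Here C(N, m) is replaced by the larger N^m / m!, so that every factor becomes a
    quotient with a known limit.\<close>
  let ?g = "\<lambda>N. fact ?m * pattern_sum (\<lambda>x a. real (nat \<lfloor>x * real N\<rfloor> choose a) / real N ^ a) as q"
  have q0: "\<forall>x\<in>set q. 0 \<le> x" using q by (auto simp: prob_list_def)
  have "?g \<longlonglongrightarrow> fact ?m * pattern_sum (\<lambda>x a. x ^ a / fact a) as q"
    using q0 by (intro tendsto_mult tendsto_const pattern_sum_tendsto choose_over_power_tendsto floor_over_tendsto) auto
  also have "fact ?m * pattern_sum (\<lambda>x a. x ^ a / fact a) as q = multinomial as * layer_poly as q"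
  proof -
    have "(\<Prod>a\<leftarrow>as. 1 / fact a) = (1 / (\<Prod>a\<leftarrow>as. fact a) :: real)"
      by (induction as) auto
    then show ?thesis
      using pattern_sum_scale[of "\<lambda>x a. x ^ a :: real" "\<lambda>a. 1 / fact a" as q] by (simp add: multinomial_def)
  qed
  finally show "?g \<longlonglongrightarrow> multinomial as * layer_poly as q" .
  have "?g N \<le> max_density ?m \<sigma> N" if N: "N \<ge> Suc ?m" for N
  proof -
    have "real (sum_list (?c N)) \<le> sum_list (map (\<lambda>x. x * real N) q)"
      using q0 by (induction q) (auto intro!: add_mono)
    also have "\<dots> = real N" using q by (simp add: sum_list_mult_const prob_list_def)
    finally have "sum_list (?c N) \<le> N" by simp
    then obtain \<pi> where \<pi>: "\<pi> permutes {1..N}"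
      and card: "pattern_sum (\<lambda>x a. x choose a) as (?c N) \<le> card (induced_sets ?m \<sigma> N \<pi>)"
      using card_induced_sets_layered_ge[OF \<sigma> as] by blast
    let ?P = "real (pattern_sum (\<lambda>x a. x choose a) as (?c N))"
    have P: "?P = pattern_sum (\<lambda>x a. real (nat \<lfloor>x * real N\<rfloor> choose a)) as q"
      by (simp add: of_nat_pattern_sum pattern_sum_map)
    have "(\<Prod>a\<leftarrow>as. 1 / real N ^ a) = 1 / real N ^ ?m"
      by (induction as) (auto simp: power_add)
    then have "?g N = fact ?m * ?P / real N ^ ?m"
      using pattern_sum_scale[of "\<lambda>x a. real (nat \<lfloor>x * real N\<rfloor> choose a)" "\<lambda>a. 1 / real N ^ a" as q]
      by (simp add: P)
    also have "\<dots> \<le> ?P / real (N choose ?m)"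
    proof -
      have "real (N choose ?m) * fact ?m \<le> real N ^ ?m"
        using binomial_fact_pow[of N ?m] by (metis of_nat_fact of_nat_le_iff of_nat_mult of_nat_power)
      moreover have "0 < real (N choose ?m)" "0 < real N ^ ?m" using N by auto
      ultimately show ?thesis
        using mult_left_mono[of "real (N choose ?m) * fact ?m" "real N ^ ?m" ?P] by (simp add: field_simps)
    qed
    also have "\<dots> \<le> perm_density ?m \<sigma> N \<pi>"
      unfolding perm_density_eq using card by (intro divide_right_mono) auto
    also have "\<dots> \<le> max_density ?m \<sigma> N" by (rule perm_density_le_max[OF \<pi>])
    finally show ?thesis .
  qed
  then show "\<exists>N0. \<forall>N\<ge>N0. ?g N \<le> max_density ?m \<sigma> N" by blast
qed

subsection \<open>Densities in permutons with finitely many layers\<close>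

text \<open>The event-level counterpart of \<open>pattern_sum\<close>: the points indexed by
  \<open>T\<close> fall into groups of sizes \<open>as\<close>, each inside its own member of
  \<open>Ls\<close>, in list order.\<close>

fun splits :: "nat list \<Rightarrow> 'b set list \<Rightarrow> 't set \<Rightarrow> ('t \<Rightarrow> 'b) \<Rightarrow> bool" where
  "splits [] Ls T p \<longleftrightarrow> T = {}"
| "splits (a # as) [] T p \<longleftrightarrow> False"
| "splits (a # as) (L # Ls) T p \<longleftrightarrow> splits (a # as) Ls T p \<or>
     (\<exists>T0. T0 \<subseteq> T \<and> card T0 = a \<and> (\<forall>t\<in>T0. p t \<in> L) \<and> splits as Ls (T - T0) p)"

text \<open>The union bound is taken over the cylinders given by \<open>T0\<close>; carrying the box \<open>B\<close> on the
  remaining coordinates makes an appeal to independence unnecessary.\<close>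

lemma measure_splits_le:
  fixes P :: "'b measure" and I :: "'t set"
  assumes P: "prob_space P" and I: "finite I"
  defines "M \<equiv> Pi\<^sub>M I (\<lambda>_. P)"
  assumes "T \<subseteq> I" "\<forall>L\<in>set Ls. L \<in> sets P" "\<forall>t\<in>I - T. B t \<in> sets P"
  shows "{p\<in>space M. splits as Ls T p \<and> (\<forall>t\<in>I - T. p t \<in> B t)} \<in> sets M \<and>
    measure M {p\<in>space M. splits as Ls T p \<and> (\<forall>t\<in>I - T. p t \<in> B t)} \<le>
      (\<Prod>t\<in>I - T. measure P (B t)) * (fact (card T) / (\<Prod>a\<leftarrow>as. fact a)) * layer_poly as (map (measure P) Ls)"
  using assms(4-6)
proof (induction as Ls arbitrary: T B rule: pattern_sets.induct)
  case (1 Ls)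
  interpret product: product_prob_space "\<lambda>_. P" I by (intro product_prob_spaceI P)
  interpret product: finite_product_prob_space "\<lambda>_. P" I by unfold_locales (rule I)
  show ?case
  proof (cases "T = {}")
    case True
    have "x \<in> space P" if "t \<in> I" "x \<in> B t" for t x
      using that 1(3) sets.sets_into_space[of "B t" P] True by auto
    then have "{p\<in>space M. splits [] Ls T p \<and> (\<forall>t\<in>I - T. p t \<in> B t)} = (\<Pi>\<^sub>E t\<in>I. B t)"
      unfolding M_def space_PiM using True by (auto simp: PiE_iff extensional_def)
    then show ?thesis using True 1 I by (simp add: M_def product.prob_times sets_PiM_I_finite)
  next
    case False
    \<comment> \<open>The event is empty, so only nonnegativity of the bound is left.\<close>
    then show ?thesis by (auto intro!: mult_nonneg_nonneg prod_nonneg prod_list_nonneg divide_nonneg_nonneg)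
  qed
next
  case (2 a as)
  then show ?case by simp
next
  case (3 a as L Ls)
  interpret M: prob_space M unfolding M_def by (intro prob_space_PiM P)
  let ?E = "\<lambda>as Ls T B. {p\<in>space M. splits as Ls T p \<and> (\<forall>t\<in>I - T. p t \<in> B t)}"
  let ?C = "{T0. T0 \<subseteq> T \<and> card T0 = a}"
  \<comment> \<open>Choosing \<open>T0\<close> moves its coordinates into the box with side
    \<open>L\<close>, and the induction hypothesis applies to \<open>T - T0\<close>.\<close>
  let ?B = "\<lambda>T0 t. if t \<in> T0 then L else B t"
  let ?\<Pi> = "\<Prod>t\<in>I - T. measure P (B t)" and ?D = "(\<Prod>a\<leftarrow>as. fact a) :: real"
  let ?W = "layer_poly as (map (measure P) Ls)"
  have T: "finite T" "T \<subseteq> I" using 3(3) I finite_subset by auto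
  have D: "0 < ?D" by (induction as) auto
  have W: "0 \<le> ?W" by (rule layer_poly_nonneg) auto
  have \<Pi>: "0 \<le> ?\<Pi>" by (intro prod_nonneg) auto
  have C: "finite ?C" using T by simp
  have IH1: "?E (a # as) Ls T B \<in> sets M"
    "measure M (?E (a # as) Ls T B) \<le> ?\<Pi> * (fact (card T) / (fact a * ?D)) * layer_poly (a # as) (map (measure P) Ls)"
    using 3(2)[OF 3(3), of B] 3(4,5) by auto
  have IH2: "?E as Ls (T - T0) (?B T0) \<in> sets M"
    "measure M (?E as Ls (T - T0) (?B T0)) \<le> ?\<Pi> * measure P L ^ a * (fact (card T - a) / ?D) * ?W"
    if T0: "T0 \<in> ?C" for T0
  proof -
    have "(\<Prod>t\<in>(I - T) \<union> T0. measure P (?B T0 t)) =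
        (\<Prod>t\<in>I - T. measure P (?B T0 t)) * (\<Prod>t\<in>T0. measure P (?B T0 t))"
      using T0 T I by (intro prod.union_disjoint) (auto intro: finite_subset)
    also have "(\<Prod>t\<in>I - T. measure P (?B T0 t)) = ?\<Pi>"
      using T0 by (intro prod.cong) auto
    also have "(\<Prod>t\<in>T0. measure P (?B T0 t)) = measure P L ^ a" using T0 by simp
    also have "(I - T) \<union> T0 = I - (T - T0)" using T0 T by auto
    finally have prod: "(\<Prod>t\<in>I - (T - T0). measure P (?B T0 t)) = ?\<Pi> * measure P L ^ a" .
    have card: "card (T - T0) = card T - a"
      using T0 T finite_subset[of T0 T] by (auto simp: card_Diff_subset)
    have "?E as Ls (T - T0) (?B T0) \<in> sets M \<and> measure M (?E as Ls (T - T0) (?B T0)) \<le>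
        (\<Prod>t\<in>I - (T - T0). measure P (?B T0 t)) * (fact (card (T - T0)) / ?D) * ?W"
      by (rule 3(1)) (use T 3(4,5) in auto)
    then show "?E as Ls (T - T0) (?B T0) \<in> sets M"
      "measure M (?E as Ls (T - T0) (?B T0)) \<le> ?\<Pi> * measure P L ^ a * (fact (card T - a) / ?D) * ?W"
      unfolding prod card by blast+
  qed
  have eq: "?E (a # as) (L # Ls) T B = ?E (a # as) Ls T B \<union> (\<Union>T0\<in>?C. ?E as Ls (T - T0) (?B T0))"
    (is "?l = ?r")
  proof (intro set_eqI iffI)
    fix p assume p: "p \<in> ?l"
    show "p \<in> ?r"
    proof (cases "splits (a # as) Ls T p")
      case True
      then show ?thesis using p by simp
    next
      case False
      then obtain T0 where T0: "T0 \<in> ?C" "\<forall>t\<in>T0. p t \<in> L" "splits as Ls (T - T0) p" using p by auto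
      then have "p \<in> ?E as Ls (T - T0) (?B T0)" using p by auto
      then show ?thesis using T0(1) by blast
    qed
  next
    fix p assume "p \<in> ?r"
    then consider "p \<in> ?E (a # as) Ls T B" | T0 where "T0 \<in> ?C" "p \<in> ?E as Ls (T - T0) (?B T0)" by blast
    then show "p \<in> ?l"
    proof cases
      case 2
      have "p t \<in> L" if "t \<in> T0" for t
      proof -
        have "t \<in> I - (T - T0)" using that 2(1) T(2) by auto
        then have "p t \<in> ?B T0 t" using 2(2) by blast
        then show ?thesis using that by simp
      qed
      moreover have "p t \<in> B t" if "t \<in> I - T" for t
      proof -
        have "t \<in> I - (T - T0)" using that by auto
        then have "p t \<in> ?B T0 t" using 2(2) by blast
        moreover have "t \<notin> T0" using that 2(1) by auto
        ultimately show ?thesis by simp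
      qed
      ultimately show ?thesis using 2 by auto
    qed auto
  qed
  have sets: "(\<Union>T0\<in>?C. ?E as Ls (T - T0) (?B T0)) \<in> sets M"
    by (intro sets.finite_UN C IH2(1))
  have "measure M (?E (a # as) (L # Ls) T B) \<le>
      measure M (?E (a # as) Ls T B) + measure M (\<Union>T0\<in>?C. ?E as Ls (T - T0) (?B T0))"
    unfolding eq by (rule measure_Un_le[OF IH1(1) sets])
  also have "measure M (\<Union>T0\<in>?C. ?E as Ls (T - T0) (?B T0)) \<le> (\<Sum>T0\<in>?C. measure M (?E as Ls (T - T0) (?B T0)))"
    by (intro M.finite_measure_subadditive_finite C image_subsetI IH2(1))
  also have "\<dots> \<le> (\<Sum>T0\<in>?C. ?\<Pi> * measure P L ^ a * (fact (card T - a) / ?D) * ?W)"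
    by (intro sum_mono IH2(2))
  also have "\<dots> = ?\<Pi> * measure P L ^ a * (real (card T choose a) * fact (card T - a) / ?D) * ?W"
    using T by (simp add: n_subsets)
  also have "\<dots> \<le> ?\<Pi> * measure P L ^ a * (fact (card T) / (fact a * ?D)) * ?W"
  proof (intro mult_right_mono mult_left_mono)
    \<comment> \<open>Equality holds for a <= card T; otherwise the binomial coefficient is
      zero.\<close>
    have "real (card T choose a) * fact (card T - a) \<le> fact (card T) / fact a"
      by (cases "a \<le> card T") (simp_all add: binomial_fact binomial_eq_0)
    then have "real (card T choose a) * fact (card T - a) / ?D \<le> fact (card T) / fact a / ?D"
      using D by (intro divide_right_mono) auto
    then show "real (card T choose a) * fact (card T - a) / ?D \<le> fact (card T) / (fact a * ?D)" by simp
  qed (use W \<Pi> in auto)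
  finally have "measure M (?E (a # as) (L # Ls) T B) \<le>
      ?\<Pi> * (fact (card T) / (fact a * ?D)) * layer_poly (a # as) (map (measure P) (L # Ls))"
    using IH1(2) by (simp add: algebra_simps)
  moreover have "?E (a # as) (L # Ls) T B \<in> sets M"
    unfolding eq by (rule sets.Un[OF IH1(1) sets])
  ultimately show ?case by simp
qed

text \<open>Induction on the labels. If the least label \<open>j\<close> occurs at the first
  position, exactly the first layer carries it and the rest is shifted by \<open>a\<close>; if not,
  monotonicity rules \<open>j\<close> out altogether.\<close>

lemma splits_of_labels:
  fixes js :: "'j::linorder list"
  assumes "sorted_wrt (<) js" "\<forall>a\<in>set as. 0 < a" "bij_betw \<tau> {1..sum_list as} T"
    and "\<And>x. x \<in> {1..sum_list as} \<Longrightarrow> lab (\<tau> x) \<in> set js"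
    and "\<And>x y. x \<in> {1..sum_list as} \<Longrightarrow> y \<in> {1..sum_list as} \<Longrightarrow> x \<le> y \<Longrightarrow> lab (\<tau> x) \<le> lab (\<tau> y)"
    and "\<And>x y. x \<in> {1..sum_list as} \<Longrightarrow> y \<in> {1..sum_list as} \<Longrightarrow>
      layer_index as x = layer_index as y \<longleftrightarrow> lab (\<tau> x) = lab (\<tau> y)"
    and "\<And>t. t \<in> T \<Longrightarrow> p t \<in> L (lab t)"
  shows "splits as (map L js) T p"
  using assms
proof (induction js arbitrary: as T \<tau>)
  case Nil
  show ?case
  proof (cases as)
    case Nil
    then show ?thesis using Nil.prems(3) by (auto simp: bij_betw_def)
  next
    case (Cons a as')
    then show ?thesis using Nil.prems(2) Nil.prems(4)[of 1] by simp
  qed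
next
  case (Cons j js)
  show ?case
  proof (cases as)
    case Nil
    then show ?thesis using Cons.prems(3) by (auto simp: bij_betw_def)
  next
    case as: (Cons a as')
    let ?m = "sum_list as" and ?m' = "sum_list as'"
    have a: "0 < a" using Cons.prems(2) as by simp
    have one: "1 \<in> {1..?m}" using a as by simp
    note inj = bij_betw_imp_inj_on[OF Cons.prems(3)] and img = bij_betw_imp_surj_on[OF Cons.prems(3)]
    show ?thesis
    proof (cases "lab (\<tau> 1) = j")
      case True
      let ?T0 = "\<tau> ` {1..a}" and ?\<tau> = "\<lambda>x. \<tau> (x + a)"
      have sub: "{1..a} \<subseteq> {1..?m}" by (auto simp: as)
      have shift: "(\<lambda>x. x + a) ` {1..?m'} = {1..?m} - {1..a}"
        by (auto simp: as image_iff intro!: bexI[of _ "_ - a"])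
      have in_shift: "x + a \<in> {1..?m}" if "x \<in> {1..?m'}" for x using that by (simp add: as)
      have index_shift: "layer_index as (x + a) = Suc (layer_index as' x)" if "x \<in> {1..?m'}" for x
        using that by (simp add: as)
      have T0: "?T0 \<subseteq> T" using sub img by blast
      have "?\<tau> ` {1..?m'} = \<tau> ` (\<lambda>x. x + a) ` {1..?m'}" unfolding image_image ..
      also have "\<dots> = T - ?T0"
        unfolding shift img[symmetric] by (rule inj_on_image_set_diff[OF inj _ sub]) auto
      finally have bij': "bij_betw ?\<tau> {1..?m'} (T - ?T0)"
        unfolding bij_betw_def
        using inj_onD[OF inj] in_shift by (intro conjI inj_onI) (metis add_right_cancel)
      have "splits as' (map L js) (T - ?T0) p"
      proof (rule Cons.IH[OF _ _ bij'])
        show "sorted_wrt (<) js" "\<forall>a\<in>set as'. 0 < a" using Cons.prems(1,2) as by auto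
        show "lab (?\<tau> x) \<in> set js" if x: "x \<in> {1..?m'}" for x
        proof -
          have "layer_index as (x + a) \<noteq> layer_index as 1" using index_shift[OF x] a by (simp add: as)
          then have "lab (?\<tau> x) \<noteq> j" using Cons.prems(6)[OF in_shift[OF x] one] True by simp
          then show ?thesis using Cons.prems(4)[OF in_shift[OF x]] by simp
        qed
        show "lab (?\<tau> x) \<le> lab (?\<tau> y)" if "x \<in> {1..?m'}" "y \<in> {1..?m'}" "x \<le> y" for x y
          using that in_shift by (intro Cons.prems(5)) auto
        show "layer_index as' x = layer_index as' y \<longleftrightarrow> lab (?\<tau> x) = lab (?\<tau> y)"
          if "x \<in> {1..?m'}" "y \<in> {1..?m'}" for x y
          using Cons.prems(6)[OF that[THEN in_shift]] that[THEN index_shift] by simp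
        show "p t \<in> L (lab t)" if "t \<in> T - ?T0" for t using that Cons.prems(7) by blast
      qed
      moreover have "card ?T0 = a" using card_image[OF inj_on_subset[OF inj sub]] by simp
      moreover have "p t \<in> L j" if "t \<in> ?T0" for t
      proof -
        from that obtain x where x: "x \<in> {1..a}" "t = \<tau> x" by blast
        then have "lab t = j"
          using Cons.prems(6)[of x 1] sub one True a by (auto simp: as)
        then show ?thesis using Cons.prems(7)[of t] that T0 by auto
      qed
      ultimately show ?thesis using T0 unfolding as by auto
    next
      case False
      then have "j < lab (\<tau> 1)" using Cons.prems(1) Cons.prems(4)[OF one] by auto
      then have "lab (\<tau> x) \<in> set js" if "x \<in> {1..?m}" for x
        using Cons.prems(4)[OF that] Cons.prems(5)[OF one that] that by auto
      then have "splits as (map L js) T p"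
        using Cons.prems by (intro Cons.IH[of as \<tau> T]) auto
      then show ?thesis unfolding as by simp
    qed
  qed
qed

section \<open>The support of a permuton and its nondegenerate layers\<close>

lemma AE_measure_support:
  fixes P :: "'a::second_countable_topology measure"
  assumes "sets P = sets borel"
  shows "AE z in P. z \<in> measure_support P"
proof -
  obtain \<B> :: "'a set set" where \<B>: "countable \<B>" "topological_basis \<B>"
    using ex_countable_basis by blast
  \<comment> \<open>A point outside the support lies in a basic open set of measure zero, and there
    are only countably many of these.\<close>
  let ?N = "\<Union>{U\<in>\<B>. emeasure P U = 0}"
  have "?N \<in> null_sets P"
  proof -
    have "(\<Union>U\<in>{U\<in>\<B>. emeasure P U = 0}. U) \<in> null_sets P"
      using \<B> topological_basis_open[OF \<B>(2)] assms
      by (intro null_sets_UN') (auto intro!: null_setsI)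
    then show ?thesis by simp
  qed
  then show ?thesis
  proof (rule AE_mp[OF AE_not_in AE_I2], intro impI)
    fix z assume z: "z \<notin> ?N"
    show "z \<in> measure_support P"
      unfolding measure_support_def
    proof (intro CollectI allI impI)
      fix U assume U: "open U \<and> z \<in> U"
      then obtain V where V: "V \<in> \<B>" "z \<in> V" "V \<subseteq> U"
        using topological_basisE[OF \<B>(2)] by metis
      then have "0 < emeasure P V" using z by (auto simp: zero_less_iff_neq_zero)
      also have "\<dots> \<le> emeasure P U" using V U assms by (intro emeasure_mono) auto
      finally show "0 < emeasure P U" .
    qed
  qed
qed

text \<open>The uniform marginal has no atoms.\<close>

lemma permuton_AE_fst_neq:
  assumes "permuton P"
  shows "AE z in P. fst z \<noteq> c"
proof -
  have sets: "sets P = sets borel" and fst: "distr P borel fst = uniform_measure lborel {0..1}"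
    using assms by (auto simp: permuton_def)
  have meas: "fst \<in> P \<rightarrow>\<^sub>M borel"
    unfolding measurable_cong_sets[OF sets refl]
    by (intro borel_measurable_continuous_onI continuous_on_fst continuous_on_id)
  have "AE x in distr P borel fst. x \<noteq> c"
    unfolding fst by (intro AE_uniform_measureI AE_mp[OF AE_lborel_singleton AE_I2]) auto
  then show ?thesis using AE_distrD[OF meas] by blast
qed

text \<open>A layer is labelled by its left endpoint, since nondegenerate layers are determined by it.\<close>

definition layer_starts :: "real set set \<Rightarrow> real set" where
  "layer_starts J = {a. \<exists>b>a. {a..b} \<in> J}"

text \<open>When layers have disjoint interiors, the choice is unique by
  \<open>layer_end_eqI\<close>. It is arbitrary for \<open>a\<close> outside
  \<open>layer_starts J\<close>.\<close>

definition layer_end :: "real set set \<Rightarrow> real \<Rightarrow> real" where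
  "layer_end J a = (SOME b. a < b \<and> {a..b} \<in> J)"

text \<open>The endpoints are left out so that, for layers with disjoint interiors, the segments are
  disjoint and strictly ordered in both coordinates.\<close>

definition layer_diag :: "real set set \<Rightarrow> real \<Rightarrow> (real \<times> real) set" where
  "layer_diag J a = {z. a < fst z \<and> fst z < layer_end J a \<and> snd z = a + layer_end J a - fst z}"

lemma layer_end:
  assumes "a \<in> layer_starts J"
  shows "a < layer_end J a" "{a..layer_end J a} \<in> J"
  using assms someI_ex[of "\<lambda>b. a < b \<and> {a..b} \<in> J"]
  unfolding layer_starts_def layer_end_def by auto

lemma layer_diag_borel: "layer_diag J a \<in> sets borel"
proof -
  have "open {z :: real \<times> real. a < fst z}" "open {z :: real \<times> real. fst z < layer_end J a}"
    "closed {z :: real \<times> real. snd z = a + layer_end J a - fst z}"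
    by (intro open_Collect_less closed_Collect_eq continuous_intros)+
  then have "{z. a < fst z} \<inter> {z. fst z < layer_end J a} \<inter> {z. snd z = a + layer_end J a - fst z} \<in> sets (borel :: (real \<times> real) measure)"
    by (intro sets.Int) auto
  also have "{z. a < fst z} \<inter> {z. fst z < layer_end J a} \<inter> {z. snd z = a + layer_end J a - fst z} = layer_diag J a"
    by (auto simp: layer_diag_def)
  finally show ?thesis .
qed

lemma finite_layer_starts: "finite J \<Longrightarrow> finite (layer_starts J)"
  by (rule finite_subset[of _ "Inf ` J"]) (force simp: layer_starts_def)+

lemma layers_apart:
  fixes a a' b b' :: real
  assumes "disjoint_family_on interior J" "{a..b} \<in> J" "{a'..b'} \<in> J" "a < b" "a' < b'"
    and "{a..b} \<noteq> {a'..b'}"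
  shows "b \<le> a' \<or> b' \<le> a"
proof (rule ccontr)
  assume *: "\<not> ?thesis"
  obtain x where "max a a' < x" "x < min b b'"
    using dense[of "max a a'" "min b b'"] * assms(4,5) by auto
  then have "x \<in> interior {a..b} \<inter> interior {a'..b'}" by auto
  then show False using disjoint_family_onD[OF assms(1-3) assms(6)] by auto
qed

lemma layer_end_le:
  assumes "disjoint_family_on interior J" "a \<in> layer_starts J" "a' \<in> layer_starts J" "a < a'"
  shows "layer_end J a \<le> a'"
proof -
  note e = layer_end[OF assms(2)] and e' = layer_end[OF assms(3)]
  have "a \<notin> {a'..layer_end J a'}" "a \<in> {a..layer_end J a}" using assms(4) e by auto
  then have "{a..layer_end J a} \<noteq> {a'..layer_end J a'}" by blast
  then show ?thesis using layers_apart[OF assms(1) e(2) e'(2) e(1) e'(1)] e' assms(4) by auto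
qed

lemma layer_end_eqI:
  assumes "disjoint_family_on interior J" "a < b" "{a..b} \<in> J"
  shows "a \<in> layer_starts J" "layer_end J a = b"
proof -
  show a: "a \<in> layer_starts J" using assms(2,3) by (auto simp: layer_starts_def)
  note e = layer_end[OF a]
  show "layer_end J a = b"
  proof (rule ccontr)
    assume "layer_end J a \<noteq> b"
    then have "{a..layer_end J a} \<noteq> {a..b}" using assms(2) e by (simp add: Icc_eq_Icc)
    then show False using layers_apart[OF assms(1) e(2) assms(3) e(1) assms(2)] e assms(2) by auto
  qed
qed

text \<open>Almost every point lies in the support, hence on the antidiagonal of some layer. The
  endpoints of finitely many layers are almost surely avoided, which also discards layers of length
  zero.\<close>

lemma layering_AE_layer_diag:
  assumes "layering P J" "finite J"
  shows "AE z in P. \<exists>a\<in>layer_starts J. z \<in> layer_diag J a"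
proof -
  have P: "permuton P" and disj: "disjoint_family_on interior J"
    and supp: "measure_support P = {(x, y). \<exists>a b. {a..b} \<in> J \<and> x \<in> {a..b} \<and> y = b - (x - a)}"
    using assms(1) by (auto simp: layering_def)
  have "AE z in P. z \<in> measure_support P" using P by (intro AE_measure_support) (simp add: permuton_def)
  moreover have "AE z in P. \<forall>c\<in>Inf ` J \<union> Sup ` J. fst z \<noteq> c"
    using assms(2) P by (intro AE_finite_allI permuton_AE_fst_neq) auto
  ultimately show ?thesis
  proof eventually_elim
    case (elim z)
    then obtain a b where ab: "{a..b} \<in> J" "fst z \<in> {a..b}" "snd z = b - (fst z - a)"
      unfolding supp by (auto simp: case_prod_beta)
    have le: "a \<le> b" using ab(2) by simp
    have "Inf {a..b} \<in> Inf ` J \<union> Sup ` J" "Sup {a..b} \<in> Inf ` J \<union> Sup ` J" using ab(1) by blast+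
    then have "fst z \<noteq> a" "fst z \<noteq> b" using elim(2) le by auto
    then have "a < fst z" "fst z < b" using ab(2) by auto
    moreover from this have "a < b" by simp
    ultimately show ?case
      using layer_end_eqI[OF disj _ ab(1)] ab(3) by (intro bexI[of _ a]) (auto simp: layer_diag_def)
  qed
qed

lemma layer_diag_disjoint:
  assumes "disjoint_family_on interior J"
  shows "disjoint_family_on (layer_diag J) (layer_starts J)"
proof -
  have "layer_diag J a \<inter> layer_diag J a' = {}" if "a \<in> layer_starts J" "a' \<in> layer_starts J" "a < a'" for a a'
    using layer_end_le[OF assms that] by (auto simp: layer_diag_def)
  then show ?thesis unfolding disjoint_family_on_def by (metis Int_commute linorder_neqE)
qed

section \<open>Bounding the pattern density by the layer weights\<close>

definition layer_weights :: "(real \<times> real) measure \<Rightarrow> real set set \<Rightarrow> real list" where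
  "layer_weights P J = map (\<lambda>a. measure P (layer_diag J a)) (sorted_list_of_set (layer_starts J))"

text \<open>The open segments are disjoint and cover almost every point; their measures take the
  place of layer lengths.\<close>

lemma sum_list_layer_weights:
  assumes "layering P J" "finite J"
  shows "sum_list (layer_weights P J) = 1"
proof -
  have sets: "sets P = sets borel" and disj: "disjoint_family_on interior J" and "prob_space P"
    using assms(1) by (auto simp: layering_def permuton_def)
  then interpret prob_space P by simp
  have fin: "finite (layer_starts J)" using assms(2) by (rule finite_layer_starts)
  have U: "(\<Union>a\<in>layer_starts J. layer_diag J a) \<in> sets P"
    using fin layer_diag_borel sets by (intro sets.finite_UN) auto
  have "sum_list (layer_weights P J) = (\<Sum>a\<in>layer_starts J. measure P (layer_diag J a))"
    using fin by (simp add: layer_weights_def sum_list_distinct_conv_sum_set)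
  also have "\<dots> = measure P (\<Union>a\<in>layer_starts J. layer_diag J a)"
    using fin layer_diag_borel sets layer_diag_disjoint[OF disj]
    by (intro finite_measure_finite_Union[symmetric]) auto
  also have "\<dots> = 1"
    using layering_AE_layer_diag[OF assms] by (subst prob_eq_1[OF U]) simp
  finally show ?thesis .
qed

text \<open>Almost every sample inducing \<sigma> splits into groups along increasing layers, and
  \<open>measure_splits_le\<close> bounds the probability of that.\<close>

lemma permuton_density_le:
  assumes \<sigma>: "layered_perm as \<sigma>" and as: "\<forall>a\<in>set as. 0 < a" and J: "layering P J" "finite J"
  shows "permuton_density (sum_list as) \<sigma> P \<le> multinomial as * layer_poly as (layer_weights P J)"
proof -
  let ?m = "sum_list as" and ?js = "sorted_list_of_set (layer_starts J)"
  let ?Ls = "map (layer_diag J) ?js" and ?M = "Pi\<^sub>M {1..sum_list as} (\<lambda>_. P)"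
  have P: "prob_space P" and sets: "sets P = sets borel" and disj: "disjoint_family_on interior J"
    using J(1) by (auto simp: layering_def permuton_def)
  interpret M: prob_space ?M by (intro prob_space_PiM P)
  let ?E = "{p \<in> space ?M. \<exists>\<tau>. \<tau> permutes {1..?m} \<and>
            (\<forall>i\<in>{1..?m}. \<forall>j\<in>{1..?m}. i < j \<longrightarrow> fst (p (\<tau> i)) < fst (p (\<tau> j))) \<and>
            (\<forall>i\<in>{1..?m}. \<forall>j\<in>{1..?m}. \<sigma> i < \<sigma> j \<longleftrightarrow> snd (p (\<tau> i)) < snd (p (\<tau> j)))}"
  let ?F = "{p \<in> space ?M. splits as ?Ls {1..?m} p}"
  \<comment> \<open>With \<open>T\<close> the whole index set the box condition is vacuous, hence
    the dummy box \<open>{}\<close>.\<close>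
  have F: "?F \<in> sets ?M"
    "measure ?M ?F \<le> multinomial as * layer_poly as (layer_weights P J)"
    using measure_splits_le[OF P, of "{1..?m}" "{1..?m}" ?Ls "\<lambda>_. {}" as] layer_diag_borel sets
    by (auto simp: multinomial_def layer_weights_def comp_def)
  have "AE p in ?M. \<forall>t\<in>{1..?m}. \<exists>a\<in>layer_starts J. p t \<in> layer_diag J a"
    using layering_AE_layer_diag[OF J] P
    by (intro AE_finite_allI AE_PiM_component) auto
  then have "AE p in ?M. p \<in> ?E \<longrightarrow> p \<in> ?F"
  proof eventually_elim
    case (elim p)
    show ?case
    proof
      assume "p \<in> ?E"
      then obtain \<tau> where p: "p \<in> space ?M" and \<tau>: "\<tau> permutes {1..?m}"
        and fst: "\<And>i j. i \<in> {1..?m} \<Longrightarrow> j \<in> {1..?m} \<Longrightarrow> i < j \<Longrightarrow> fst (p (\<tau> i)) < fst (p (\<tau> j))"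
        and snd: "\<And>i j. i \<in> {1..?m} \<Longrightarrow> j \<in> {1..?m} \<Longrightarrow> \<sigma> i < \<sigma> j \<longleftrightarrow> snd (p (\<tau> i)) < snd (p (\<tau> j))"
        by blast
      from elim obtain lab where lab:
        "\<And>t. t \<in> {1..?m} \<Longrightarrow> lab t \<in> layer_starts J" "\<And>t. t \<in> {1..?m} \<Longrightarrow> p t \<in> layer_diag J (lab t)"
        by metis
      have \<tau>in: "\<tau> x \<in> {1..?m}" if "x \<in> {1..?m}" for x using that permutes_in_image[OF \<tau>] by blast
      have mem: "lab (\<tau> x) < fst (p (\<tau> x))" "fst (p (\<tau> x)) < layer_end J (lab (\<tau> x))"
        "snd (p (\<tau> x)) = lab (\<tau> x) + layer_end J (lab (\<tau> x)) - fst (p (\<tau> x))" if "x \<in> {1..?m}" for x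
        using lab(2)[OF \<tau>in[OF that]] by (auto simp: layer_diag_def)
      have end_le: "layer_end J (lab (\<tau> x)) \<le> lab (\<tau> y)"
        if "x \<in> {1..?m}" "y \<in> {1..?m}" "lab (\<tau> x) < lab (\<tau> y)" for x y
        using that lab(1) \<tau>in by (intro layer_end_le[OF disj]) auto
      \<comment> \<open>The points of a later layer lie further right, so sorting by the first
        coordinate sorts the labels.\<close>
      have mono: "lab (\<tau> x) \<le> lab (\<tau> y)" if xy: "x \<in> {1..?m}" "y \<in> {1..?m}" "x < y" for x y
      proof (rule ccontr)
        assume "\<not> ?thesis"
        then have "layer_end J (lab (\<tau> y)) \<le> lab (\<tau> x)" using xy by (intro end_le) auto
        then show False using mem(1)[OF xy(1)] mem(2)[OF xy(2)] fst[OF xy] by linarith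
      qed
      \<comment> \<open>Along a segment the second coordinate falls as the first grows; between
        layers it rises. Comparison with \<sigma> matches layers of the pattern with layers of the
        permuton.\<close>
      have index: "layer_index as x = layer_index as y \<longleftrightarrow> lab (\<tau> x) = lab (\<tau> y)"
        if xy: "x \<in> {1..?m}" "y \<in> {1..?m}" "x < y" for x y
      proof -
        have "layer_index as x \<noteq> layer_index as y \<longleftrightarrow> snd (p (\<tau> x)) < snd (p (\<tau> y))"
          using layered_perm_less_iff[OF \<sigma>, of x y] snd[OF xy(1,2)] xy by simp
        also have "\<dots> \<longleftrightarrow> lab (\<tau> x) \<noteq> lab (\<tau> y)"
        proof (cases "lab (\<tau> x) = lab (\<tau> y)")
          case True
          then show ?thesis using mem(3)[OF xy(1)] mem(3)[OF xy(2)] fst[OF xy] by simp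
        next
          case False
          then have "layer_end J (lab (\<tau> x)) \<le> lab (\<tau> y)" using xy mono[OF xy] by (intro end_le) auto
          then show ?thesis using False mem[OF xy(1)] mem[OF xy(2)] by simp
        qed
        finally show ?thesis by blast
      qed
      have "splits as ?Ls {1..?m} p"
      proof (rule splits_of_labels[where lab = lab and \<tau> = \<tau>])
        show "sorted_wrt (<) ?js" by (rule strict_sorted_list_of_set)
        show "bij_betw \<tau> {1..?m} {1..?m}" by (rule permutes_imp_bij[OF \<tau>])
        show "lab (\<tau> x) \<in> set ?js" if "x \<in> {1..?m}" for x
          using lab(1)[OF \<tau>in[OF that]] finite_layer_starts[OF J(2)] by simp
        show "lab (\<tau> x) \<le> lab (\<tau> y)" if "x \<in> {1..?m}" "y \<in> {1..?m}" "x \<le> y" for x y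
          using mono[OF that(1,2)] that(3) by (cases "x = y") auto
        show "layer_index as x = layer_index as y \<longleftrightarrow> lab (\<tau> x) = lab (\<tau> y)"
          if "x \<in> {1..?m}" "y \<in> {1..?m}" for x y
          using index[OF that] index[OF that(2,1)] by (cases x y rule: linorder_cases) auto
      qed (use as lab in auto)
      then show "p \<in> ?F" using p by simp
    qed
  qed
  then have "measure ?M ?E \<le> measure ?M ?F" by (intro M.finite_measure_mono_AE F(1))
  then show ?thesis using F(2) unfolding permuton_density_def by linarith
qed

theorem theorem3p1:
  fixes k :: nat and ls :: "nat list"
  assumes "length ls = k" and "\<forall>l\<in>set ls. 0 < l"
  shows "\<exists>n0. \<forall>n\<ge>n0. \<forall>\<sigma>. layered_perm (n # 1 # ls) \<sigma> \<longrightarrow>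
           (\<forall>P J. optimal_permuton (sum_list (n # 1 # ls)) \<sigma> P \<and> layering P J \<longrightarrow> infinite J)"
proof -
  obtain n0 where n0: "\<And>n p. n \<ge> n0 \<Longrightarrow> prob_list p \<Longrightarrow>
      \<exists>q. prob_list q \<and> layer_poly (n # 1 # ls) p < layer_poly (n # 1 # ls) q"
    using layer_poly_not_maximal[OF assms(2)] by blast
  show ?thesis
  \<comment> \<open>The maximum with 1 keeps the first layer size positive.\<close>
  proof (intro exI[of _ "max 1 n0"] allI impI notI)
    fix n \<sigma> P J
    let ?as = "n # 1 # ls"
    assume n: "max 1 n0 \<le> n" and \<sigma>: "layered_perm ?as \<sigma>"
      and opt: "optimal_permuton (sum_list ?as) \<sigma> P \<and> layering P J" and J: "finite J"
    have as: "\<forall>a\<in>set ?as. 0 < a" using assms(2) n by auto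
    let ?w = "layer_weights P J"
    let ?p = "filter (\<lambda>x. 0 < x) ?w"
    have w: "\<forall>x\<in>set ?w. 0 \<le> x" "sum_list ?w = 1"
      using sum_list_layer_weights opt J by (auto simp: layer_weights_def)
    have "sum_list (filter (\<lambda>x. 0 < x) xs) = sum_list xs" if "\<forall>x\<in>set xs. 0 \<le> x" for xs :: "real list"
      using that by (induction xs) auto
    then have "prob_list ?p" using w by (simp add: prob_list_def)
    then obtain q where q: "prob_list q" "layer_poly ?as ?p < layer_poly ?as q"
      using n0[of n ?p] n by auto
    \<comment> \<open>With finitely many layers the density stays strictly below the packing
      density, contradicting optimality.\<close>
    have "permuton_density (sum_list ?as) \<sigma> P \<le> multinomial ?as * layer_poly ?as ?p"
      unfolding layer_poly_filter_pos[OF as w(1)]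
      using opt J by (intro permuton_density_le \<sigma> as) auto
    also have "\<dots> < multinomial ?as * layer_poly ?as q"
    proof (intro mult_strict_left_mono q(2))
      have "0 < (\<Prod>a\<leftarrow>as. fact a :: real)" for as by (induction as) auto
      then show "0 < multinomial ?as" unfolding multinomial_def by (intro divide_pos_pos) auto
    qed
    also have "\<dots> \<le> packing_density (sum_list ?as) \<sigma>"
      by (rule layer_poly_le_packing_density[OF \<sigma> as q(1)])
    finally show False using opt by (simp add: optimal_permuton_def)
  qed
qed

end
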